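(* Let $f\in\mathbb{Z}[x,z]$ be a homogeneous irreducible polynomial of degree $5$. Let $$\delta(N)=\#\{(x,z)\in\mathbb{Z}^2:|x|,|z|\le N,\ \gcd(x,z)=1,\ \exists\text{ prime }p>N\text{ s.t. }p^2\mid f(x,z)\}.$$ Then, for any $\epsilon>0$, $\delta(N)\ll N^{(5+\sqrt{113})/8+\epsilon}$, where the implied constant depends only on $f$ and $\epsilon$.
   Context: Here $N$ is a positive integer. *)

theory Defs
  imports Complex_Main "HOL-Computational_Algebra.Computational_Algebra"
begin

text \<open>
  The ring \<open>\<int>[x, z]\<close> is represented as \<open>\<int>[x][z]\<close>, i.e. by the type \<^typ>\<open>int poly poly\<close>: the
  coefficient of \<open>x\<^sup>j z\<^sup>i\<close> in \<open>f\<close> is \<open>coeff (coeff f i) j\<close>.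
\<close>

definition eval2 :: "'a::comm_ring_1 poly poly \<Rightarrow> 'a \<Rightarrow> 'a \<Rightarrow> 'a" where
  "eval2 f x z = poly (poly f [:z:]) x"

definition homogeneous_of_degree :: "nat \<Rightarrow> 'a::zero poly poly \<Rightarrow> bool" where
  "homogeneous_of_degree d f \<longleftrightarrow>
     f \<noteq> 0 \<and> (\<forall>i j. coeff (coeff f i) j \<noteq> 0 \<longrightarrow> i + j = d)"

definition delta :: "int poly poly \<Rightarrow> nat \<Rightarrow> nat" where
  "delta f N = card {(x :: int, z :: int).
     \<bar>x\<bar> \<le> int N \<and> \<bar>z\<bar> \<le> int N \<and> gcd x z = 1 \<and>
     (\<exists>p :: int. prime p \<and> p > int N \<and> p\<^sup>2 dvd eval2 f x z)}"

end

theory Submission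
  imports "HOL-Real_Asymp.Real_Asymp" "HOL-Library.Discrete_Functions" Defs
    "HOL-Number_Theory.Number_Theory"
begin

hide_const (open) up_ring.coeff up_ring.monom Module.smult

text \<open>
  The exponent obtained here is \<open>39/20\<close>, slightly below \<open>(5 + \<surd>113)/8\<close>, and no arithmetic of
  elliptic curves or of curves of higher genus enters. For a prime \<open>p > N\<close> the points with
  \<open>p\<^sup>2 | f(x, z)\<close> lie on at most five lattices of index \<open>p\<^sup>2 > N\<^sup>2\<close>, each of which has boundedly many
  primitive points in the box, so the primes up to \<open>M = N\<^bsup>39/20\<^esup>\<close> contribute \<open>O(M)\<close>. If \<open>p > M\<close>, then
  the squarefree part of \<open>f(x, z)\<close> is \<open>O(N\<^sup>5/M\<^sup>2)\<close>. Up to a bounded factor it is a number \<open>m\<close>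
  coprime to the leading coefficient, and \<open>(x, z)\<close> lies on one of at most \<open>5\<^bsup>\<omega>(m)\<^esup>\<close> lattices of
  index \<open>m\<close>. In coordinates with respect to a reduced basis of the lattice, a multiple of \<open>f\<close> has to be
  a square. The square sieve detects this: since the degree is odd, the complete character sums modulo
  products of two primes vanish by homogeneity. This saves a power of \<open>N\<close> unless the lattice has
  a very short vector \<open>w\<close>. But then \<open>m | f(w) \<noteq> 0\<close>, and there are few such pairs \<open>(m, w)\<close>.
\<close>

subsection \<open>Binary forms and their dehomogenization\<close>

text \<open>Put M = N^t, so that m runs up to D ~ N^(5-2t). Bounding the points on each lattice by
  about N^2/m and summing over m gives N^2 up to N^o(1), whatever t is; an exponent below 2
  therefore needs a power saving on almost all lattices. In a reduced basis the coordinate box has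
  sides U \<ge> V with UV ~ N^2/m. Sieving with Q primes up to B replaces UV by about UV(1/Q +
  B^2/W), but only if V \<ge> W, since the error of the sieve is proportional to the perimeter of
  the box and not to its area. The lattices with V < W contain a nonzero vector of length at most K
  = WD/(2N). Up to N^o(1) there are K^2 of them with O(NW) points each, in total about N W^3
  (D/N)^2. This is affordable because D is only slightly larger than N: t = 39/20 gives D/N ~
  N^(1/10). The restriction to m coprime to the leading coefficient makes z invertible modulo m, so
  that each point determines a root of F modulo m.\<close>

definition binary_form :: "nat \<Rightarrow> int poly \<Rightarrow> int \<Rightarrow> int \<Rightarrow> int" where
  "binary_form n F x z = (\<Sum>j\<le>n. coeff F j * x ^ j * z ^ (n - j))"

lemma binary_form_scale: "binary_form n F (l * x) (l * z) = l ^ n * binary_form n F x z"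
proof -
  have "coeff F j * (l * x) ^ j * (l * z) ^ (n - j) = l ^ n * (coeff F j * x ^ j * z ^ (n - j))"
    if "j \<le> n" for j
    using that power_add[of l j "n - j"] by (simp add: power_mult_distrib)
  then show ?thesis
    unfolding binary_form_def sum_distrib_left by (intro sum.cong) auto
qed

lemma binary_form_one: "degree F \<le> n \<Longrightarrow> binary_form n F x 1 = poly F x"
  unfolding binary_form_def poly_altdef
  by (intro sum.mono_neutral_cong_right) (auto simp: coeff_eq_0)

lemma binary_form_zero_right: "binary_form n F x 0 = coeff F n * x ^ n"
proof -
  have "binary_form n F x 0 = (\<Sum>j\<in>{n}. coeff F j * x ^ j * 0 ^ (n - j))"
    unfolding binary_form_def by (intro sum.mono_neutral_right) auto
  then show ?thesis by simp
qed

lemma binary_form_cong: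
  assumes "[x = x'] (mod q)" "[z = z'] (mod q)"
  shows "[binary_form n F x z = binary_form n F x' z'] (mod q)"
  unfolding binary_form_def
  by (intro cong_sum cong_mult cong_pow assms cong_refl)

lemma abs_binary_form_le:
  assumes "\<bar>x\<bar> \<le> B" "\<bar>z\<bar> \<le> B"
  shows "\<bar>binary_form n F x z\<bar> \<le> (\<Sum>j\<le>n. \<bar>coeff F j\<bar>) * B ^ n"
proof -
  have "\<bar>binary_form n F x z\<bar> \<le> (\<Sum>j\<le>n. \<bar>coeff F j * x ^ j * z ^ (n - j)\<bar>)"
    unfolding binary_form_def by (rule sum_abs)
  also have "\<dots> \<le> (\<Sum>j\<le>n. \<bar>coeff F j\<bar> * B ^ n)"
  proof (rule sum_mono)
    fix j assume "j \<in> {..n}"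
    have "\<bar>x\<bar> ^ j * \<bar>z\<bar> ^ (n - j) \<le> B ^ j * B ^ (n - j)"
      using assms by (intro mult_mono power_mono) auto
    also have "\<dots> = B ^ n" using \<open>j \<in> {..n}\<close> by (simp flip: power_add)
    finally have "\<bar>coeff F j\<bar> * (\<bar>x\<bar> ^ j * \<bar>z\<bar> ^ (n - j)) \<le> \<bar>coeff F j\<bar> * B ^ n"
      by (intro mult_left_mono) auto
    then show "\<bar>coeff F j * x ^ j * z ^ (n - j)\<bar> \<le> \<bar>coeff F j\<bar> * B ^ n"
      by (simp add: abs_mult power_abs mult.assoc)
  qed
  finally show ?thesis by (simp add: sum_distrib_right)
qed

text \<open>The target degree \<open>n\<close> is a parameter and not \<open>degree F\<close>: the
  map is then additive in \<open>F\<close>, and lower degrees are padded with powers of z. Both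
  matter when a division with remainder is homogenized.\<close>

definition homogenize :: "nat \<Rightarrow> int poly \<Rightarrow> int poly poly" where
  "homogenize n F = (\<Sum>j\<le>n. monom (monom (coeff F j) j) (n - j))"

lemma eval2_homogenize: "eval2 (homogenize n F) x z = binary_form n F x z"
proof -
  have "poly (poly (monom (monom (coeff F j) j) (n - j)) [:z:]) x = coeff F j * x ^ j * z ^ (n - j)" for j
    by (simp add: poly_monom)
  then show ?thesis
    by (simp add: eval2_def homogenize_def binary_form_def poly_sum)
qed

lemma coeff_homogenize: "coeff (homogenize n F) i = (if i \<le> n then monom (coeff F (n - i)) (n - i) else 0)"
proof (cases "i \<le> n")
  case True
  have "coeff (homogenize n F) i = (\<Sum>j\<le>n. if j = n - i then monom (coeff F j) j else 0)"
    unfolding homogenize_def coeff_sum coeff_monom using True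
    by (intro sum.cong) auto
  then show ?thesis using True by simp
next
  case False
  then show ?thesis by (auto simp: homogenize_def coeff_sum coeff_monom intro!: sum.neutral)
qed

lemma homogenize_add: "homogenize n (F + G) = homogenize n F + homogenize n G"
  by (simp add: homogenize_def sum.distrib flip: add_monom)

lemma homogenize_sum: "homogenize n (\<Sum>i\<in>A. F i) = (\<Sum>i\<in>A. homogenize n (F i))"
proof (induction A rule: infinite_finite_induct)
  case (insert x A)
  then show ?case by (simp add: homogenize_add)
qed (simp_all add: homogenize_def)

lemma homogenize_monom: "i \<le> n \<Longrightarrow> homogenize n (monom c i) = monom (monom c i) (n - i)"
  by (rule poly_eqI) (auto simp: coeff_homogenize coeff_monom)

lemma homogenize_mult:
  assumes "degree F \<le> m" "degree G \<le> n"
  shows "homogenize (m + n) (F * G) = homogenize m F * homogenize n G"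
proof -
  have F: "F = (\<Sum>i\<le>m. monom (coeff F i) i)"
    using assms(1) by (simp add: poly_as_sum_of_monoms')
  have G: "G = (\<Sum>i\<le>n. monom (coeff G i) i)"
    using assms(2) by (simp add: poly_as_sum_of_monoms')
  have "F * G = (\<Sum>i\<le>m. \<Sum>j\<le>n. monom (coeff F i * coeff G j) (i + j))"
    by (subst F, subst G) (simp add: sum_product mult_monom)
  then have "homogenize (m + n) (F * G)
     = (\<Sum>i\<le>m. \<Sum>j\<le>n. monom (monom (coeff F i * coeff G j) (i + j)) (m + n - (i + j)))"
    by (simp add: homogenize_sum homogenize_monom)
  also have "\<dots> = (\<Sum>i\<le>m. \<Sum>j\<le>n. monom (monom (coeff F i) i) (m - i) * monom (monom (coeff G j) j) (n - j))"
  proof (intro sum.cong refl)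
    fix i j assume "i \<in> {..m}" "j \<in> {..n}"
    then have "m - i + (n - j) = m + n - (i + j)" by auto
    then show "monom (monom (coeff F i * coeff G j) (i + j)) (m + n - (i + j)) =
      monom (monom (coeff F i) i) (m - i) * monom (monom (coeff G j) j) (n - j)"
      by (simp add: mult_monom)
  qed
  also have "\<dots> = homogenize m F * homogenize n G"
    by (simp add: homogenize_def sum_product)
  finally show ?thesis .
qed

text \<open>The part free of z is the leading coefficient times a power of x; in a unit it must be
  constant, which forces degree 0.\<close>

lemma homogenize_unit_imp:
  assumes "is_unit (homogenize (degree G) G)"
  shows "is_unit G"
proof -
  have G0: "coeff (homogenize (degree G) G) 0 = monom (lead_coeff G) (degree G)"
    by (simp add: coeff_homogenize)
  from assms obtain c where c: "homogenize (degree G) G = [:c:]" "is_unit c"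
    by (auto simp: is_unit_poly_iff)
  then obtain e where e: "c = [:e:]" "is_unit e"
    by (auto simp: is_unit_poly_iff)
  have "monom (lead_coeff G) (degree G) = [:e:]" using G0 c e by simp
  moreover have "e \<noteq> 0" using e by auto
  ultimately have "degree (monom (lead_coeff G) (degree G)) = 0" "G \<noteq> 0" by auto
  then have "degree G = 0" by (simp add: degree_monom_eq)
  then obtain g where "G = [:g:]" by (auto elim: degree_eq_zeroE)
  with \<open>monom (lead_coeff G) (degree G) = [:e:]\<close> e show ?thesis
    by (simp add: monom_0 is_unit_poly_iff)
qed

text \<open>A factorization of \<open>F\<close> homogenizes to one of \<open>f\<close>, provided
  that \<open>F\<close> has exact degree \<open>d\<close>. It does, because z does not divide
  \<open>f\<close>: otherwise \<open>f\<close> would be z times a unit, of degree 1 <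
  \<open>d\<close>.\<close>

lemma irreducible_dehomogenize:
  fixes f :: "int poly poly"
  assumes "homogeneous_of_degree d f" "irreducible f" "d \<ge> 2"
  obtains F where "f = homogenize d F" "degree F = d" "irreducible F"
proof -
  have hom: "coeff (coeff f i) j = 0" if "i + j \<noteq> d" for i j
    using assms(1) that by (auto simp: homogeneous_of_degree_def)
  define F where "F = (\<Sum>j\<le>d. monom (coeff (coeff f (d - j)) j) j)"
  have cF: "coeff F j = (if j \<le> d then coeff (coeff f (d - j)) j else 0)" for j
    by (auto simp: F_def coeff_sum coeff_monom)
  have f: "f = homogenize d F"
  proof (rule poly_eqI, rule poly_eqI)
    fix i j
    show "coeff (coeff f i) j = coeff (coeff (homogenize d F) i) j"
      using hom[of i j] by (auto simp: coeff_homogenize cF coeff_monom)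
  qed
  have "degree F \<le> d" by (rule degree_le) (simp add: cF)
  have "coeff F d \<noteq> 0"
  proof
    assume "coeff F d = 0"
    then have "coeff f 0 = 0" by (simp add: f coeff_homogenize)
    then obtain g where g: "f = [:0, 1:] * g" by (cases f) auto
    have "\<not> is_unit [:0, 1 :: int poly:]" by (auto simp: is_unit_poly_iff)
    with irreducibleD[OF assms(2) g] have "is_unit g" by blast
    then obtain c where "g = [:c:]" "is_unit c" by (auto simp: is_unit_poly_iff)
    then obtain e where e: "g = [:[:e:]:]" "is_unit e" by (auto simp: is_unit_poly_iff)
    then have "coeff (coeff f 1) 0 = e" using g by simp
    then show False using hom[of 1 0] assms(3) e by auto
  qed
  with \<open>degree F \<le> d\<close> have dF: "degree F = d" by (simp add: le_degree order_antisym)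
  have "irreducible F"
  proof (rule irreducibleI)
    show "F \<noteq> 0" using dF assms(3) by auto
    show "\<not> is_unit F" using dF assms(3) by (auto simp: is_unit_poly_iff)
    fix G H assume FGH: "F = G * H"
    then have "G \<noteq> 0" "H \<noteq> 0" using \<open>F \<noteq> 0\<close> by auto
    then have "d = degree G + degree H" using FGH dF by (simp add: degree_mult_eq)
    then have "f = homogenize (degree G) G * homogenize (degree H) H"
      using f FGH by (simp add: homogenize_mult)
    then have "is_unit (homogenize (degree G) G) \<or> is_unit (homogenize (degree H) H)"
      using assms(2) by (auto dest: irreducibleD)
    then show "is_unit G \<or> is_unit H" using homogenize_unit_imp by blast
  qed
  with f dF that show thesis by blast
qed

text \<open>
  Pseudo-division over \<open>\<int>\<close> produces constant multiples of \<open>F\<close>; this lemma replaces the appeal to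
  Gauss's lemma.
\<close>

lemma irreducible_dvd_smult_multiple:
  fixes F G Q :: "int poly"
  assumes "irreducible F" "smult c F = G * Q" "c \<noteq> 0" "degree G < degree F"
  shows "degree G = 0"
proof -
  have "prime_elem F" using assms(1) by (simp add: irreducible_imp_prime_elem)
  have "F \<noteq> 0" using assms(1) by auto
  with assms(3) have "smult c F \<noteq> 0" by simp
  then have nz: "G \<noteq> 0" "Q \<noteq> 0" unfolding assms(2) by auto
  have "F dvd G * Q" unfolding assms(2)[symmetric] by (simp add: dvd_smult)
  then have "F dvd G \<or> F dvd Q" using \<open>prime_elem F\<close> by (simp add: prime_elem_dvd_mult_iff)
  moreover have "\<not> F dvd G" using assms(4) nz dvd_imp_degree_le[of F G] by auto
  ultimately have "degree F \<le> degree Q" using nz dvd_imp_degree_le[of F Q] by auto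
  moreover have "degree F = degree G + degree Q"
    using arg_cong[OF assms(2), of degree] assms(3) nz by (simp add: degree_mult_eq)
  ultimately show ?thesis by simp
qed

text \<open>\<open>R\<close> plays the role of the discriminant: a prime not dividing it cannot
  divide \<open>F\<close> and its derivative at the same point. An element of least degree in the
  ideal of \<open>F\<close> and \<open>pderiv F\<close> leaves no pseudo-remainder in
  \<open>F\<close>, so irreducibility makes it constant.\<close>

lemma bezout_pderiv_irreducible:
  fixes F :: "int poly"
  assumes "irreducible F" "degree F \<ge> 1"
  obtains A B R where "A * F + B * pderiv F = [:R:]" "R \<noteq> 0"
proof -
  define I where "I = {A * F + B * pderiv F | A B. True}"
  have pd: "pderiv F \<noteq> 0" using assms by (simp add: pderiv_eq_0_iff)
  have I1: "F \<in> I" unfolding I_def by (rule CollectI, rule exI[of _ 1], rule exI[of _ 0]) simp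
  have I2: "pderiv F \<in> I" unfolding I_def by (rule CollectI, rule exI[of _ 0], rule exI[of _ 1]) simp
  have Isub: "smult c P - G * Q \<in> I" if "P \<in> I" "G \<in> I" for P G Q c
  proof -
    obtain A B A' B' where *: "P = A * F + B * pderiv F" "G = A' * F + B' * pderiv F"
      using \<open>P \<in> I\<close> \<open>G \<in> I\<close> by (auto simp: I_def)
    have "smult c P - G * Q = (smult c A - A' * Q) * F + (smult c B - B' * Q) * pderiv F"
      unfolding * by (simp add: algebra_simps smult_add_right)
    then show ?thesis unfolding I_def by blast
  qed
  obtain G where G: "G \<in> I" "G \<noteq> 0" "\<And>P. P \<in> I \<Longrightarrow> P \<noteq> 0 \<Longrightarrow> degree G \<le> degree P"
    using ex_has_least_nat[of "\<lambda>P. P \<in> I \<and> P \<noteq> 0" "pderiv F" degree] I2 pd by blast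
  obtain q r where qr: "pseudo_divmod F G = (q, r)" by fastforce
  define c where "c = coeff G (degree G) ^ (Suc (degree F) - degree G)"
  have eq: "smult c F = G * q + r" "r = 0 \<or> degree r < degree G"
    using pseudo_divmod[OF G(2) qr] by (auto simp: c_def)
  have "c \<noteq> 0" using G(2) by (simp add: c_def)
  have "r = smult c F - G * q" using eq by simp
  then have "r \<in> I" using Isub[OF I1 G(1)] by simp
  then have "r = 0" using eq(2) G(3) by (metis not_less)
  have "degree G \<le> degree (pderiv F)" using G(3)[OF I2 pd] .
  also have "\<dots> < degree F" using assms by (simp add: degree_pderiv)
  finally have "degree G = 0"
    using irreducible_dvd_smult_multiple[OF assms(1), of c G q] eq \<open>r = 0\<close> \<open>c \<noteq> 0\<close> by simp
  then obtain R where R: "G = [:R:]" by (auto elim: degree_eq_zeroE)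
  moreover obtain A B where "G = A * F + B * pderiv F" using G(1) by (auto simp: I_def)
  ultimately show thesis using that[of A B R] G(2) by auto
qed

text \<open>A zero with z \<noteq> 0 would give \<open>F\<close> a rational linear factor: z^n
  \<open>F\<close> is a multiple of zX - x plus a constant \<open>e\<close>, and evaluating the
  homogenized identity at (x, z) shows that \<open>e\<close> is the value of the form.\<close>

lemma binary_form_nonzero:
  assumes "irreducible F" "degree F = n" "n \<ge> 2" "x \<noteq> 0 \<or> z \<noteq> 0"
  shows "binary_form n F x z \<noteq> 0"
proof (cases "z = 0")
  case True
  then show ?thesis using assms leading_coeff_0_iff[of F] by (auto simp: binary_form_zero_right)
next
  case False
  define G where "G = [:-x, z:]"
  have G: "degree G = 1" "G \<noteq> 0" "coeff G (Suc 0) = z" using False by (auto simp: G_def)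
  obtain q r where qr: "pseudo_divmod F G = (q, r)" by fastforce
  have eq: "smult (z ^ n) F = G * q + r" "r = 0 \<or> degree r < 1"
    using pseudo_divmod[OF G(2) qr] by (auto simp: G assms(2))
  have "degree r = 0" using eq(2) by auto
  then obtain e where e: "r = [:e:]" by (auto elim: degree_eq_zeroE)
  have "degree (G * q) \<le> n"
  proof -
    have "G * q = smult (z ^ n) F - r" using eq by simp
    then show ?thesis using assms(2) e by (simp add: degree_diff_le)
  qed
  then have "degree q \<le> n - 1" using G assms(3) by (cases "q = 0") (simp_all add: degree_mult_eq)
  have "z ^ n * binary_form n F x z = binary_form n (smult (z ^ n) F) x z"
    by (simp add: binary_form_def sum_distrib_left mult.assoc)
  also have "\<dots> = eval2 (homogenize (1 + (n - 1)) (G * q) + homogenize n r) x z"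
    using assms(3) by (simp add: eq homogenize_add flip: eval2_homogenize)
  also have "\<dots> = binary_form 1 G x z * binary_form (n - 1) q x z + binary_form n r x z"
    unfolding homogenize_mult[OF eq_refl[OF G(1)] \<open>degree q \<le> n - 1\<close>]
    by (simp add: eval2_def flip: eval2_homogenize)
  also have "binary_form 1 G x z = 0" by (simp add: binary_form_def G_def)
  \<comment> \<open>Homogenized in degree \<open>n\<close>, the constant remainder becomes e z^n, so
    z^n cancels from both sides.\<close>
  also have "binary_form n r x z = z ^ n * e"
  proof -
    have "binary_form n r x z = (\<Sum>j\<in>{0}. coeff r j * x ^ j * z ^ (n - j))"
      unfolding binary_form_def e by (intro sum.mono_neutral_right) (auto simp: coeff_pCons split: nat.splits)
    then show ?thesis by (simp add: e)
  qed
  finally have "binary_form n F x z = e" using False by simp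
  moreover have "e \<noteq> 0"
  proof
    assume "e = 0"
    then have "degree G = 0"
      using irreducible_dvd_smult_multiple[OF assms(1), of "z ^ n" G q] eq e G assms False by simp
    then show False using G by simp
  qed
  ultimately show ?thesis by simp
qed

subsection \<open>The square sieve for forms of odd degree\<close>

lemma Legendre_cong:
  assumes "[a = b] (mod p)"
  shows "Legendre a p = Legendre b p"
proof -
  have "[a = 0] (mod p) \<longleftrightarrow> [b = 0] (mod p)" using assms by (simp add: cong_def)
  moreover have "QuadRes p a \<longleftrightarrow> QuadRes p b" using assms by (simp add: QuadRes_def cong_def)
  ultimately show ?thesis by (simp add: Legendre_def)
qed

text \<open>By Euler's criterion both sides agree modulo \<open>p\<close>, and they differ by at
  most 2 < \<open>p\<close>.\<close>

lemma Legendre_mult: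
  fixes p :: nat
  assumes "prime p" "p > 2"
  shows "Legendre (a * b) p = Legendre a p * Legendre b p"
proof -
  have "[Legendre (a * b) p = (a * b) ^ ((p - 1) div 2)] (mod int p)"
    by (rule euler_criterion[OF assms])
  also have "(a * b) ^ ((p - 1) div 2) = a ^ ((p - 1) div 2) * b ^ ((p - 1) div 2)"
    by (rule power_mult_distrib)
  also have "[\<dots> = Legendre a p * Legendre b p] (mod int p)"
    by (intro cong_mult cong_sym[OF euler_criterion] assms)
  finally have "int p dvd Legendre (a * b) p - Legendre a p * Legendre b p"
    by (simp add: cong_iff_dvd_diff)
  moreover have "\<bar>Legendre (a * b) p - Legendre a p * Legendre b p\<bar> \<le> 2"
    by (simp add: Legendre_def)
  ultimately show ?thesis
    using assms(2) zdvd_imp_le[of "int p" "\<bar>Legendre (a * b) p - Legendre a p * Legendre b p\<bar>"] by auto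
qed

lemma Legendre_power:
  fixes p :: nat
  assumes "prime p" "p > 2"
  shows "Legendre (a ^ n) p = Legendre a p ^ n"
proof (induction n)
  case 0
  have "QuadRes p 1" unfolding QuadRes_def by (rule exI[of _ 1]) simp
  then show ?case using assms by (auto simp: Legendre_def cong_def)
next
  case (Suc n)
  then show ?case using assms by (simp add: Legendre_mult)
qed

lemma Legendre_square:
  fixes p :: nat
  assumes "prime p" "\<not> int p dvd y"
  shows "Legendre (y\<^sup>2) p = 1"
proof -
  have "\<not> int p dvd y\<^sup>2" using assms prime_dvd_power[of "int p" y 2] by auto
  moreover have "QuadRes p (y\<^sup>2)" unfolding QuadRes_def by (rule exI[of _ y]) simp
  ultimately show ?thesis by (auto simp: Legendre_def cong_0_iff)
qed

text \<open>If every residue were a square, squaring would be surjective and hence injective on the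
  residues, but 1 and -1 have the same square.\<close>

lemma exists_nonresidue:
  fixes p :: nat
  assumes "prime p" "p > 2"
  obtains t where "Legendre t p = -1"
proof (rule ccontr)
  assume "\<not> thesis"
  then have "\<forall>t. Legendre t p \<noteq> -1" using that by blast
  then have "\<forall>t. (\<exists>y. [y\<^sup>2 = t] (mod int p)) \<or> [t = 0] (mod int p)"
    by (auto simp: Legendre_def QuadRes_def split: if_splits)
  moreover have "[0\<^sup>2 = t] (mod int p)" if "[t = 0] (mod int p)" for t
    using that by (simp add: cong_sym)
  ultimately have QR: "\<exists>y. [y\<^sup>2 = a] (mod int p)" for a by blast
  define sq where "sq = (\<lambda>y. y\<^sup>2 mod int p)"
  have "{0..<int p} \<subseteq> sq ` {0..<int p}"
  proof
    fix a assume a: "a \<in> {0..<int p}"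
    obtain y where "[y\<^sup>2 = a] (mod int p)" using QR by blast
    then have "sq (y mod int p) = a" using a by (simp add: sq_def cong_def power_mod)
    moreover have "y mod int p \<in> {0..<int p}" using assms by simp
    ultimately show "a \<in> sq ` {0..<int p}" by blast
  qed
  then have "inj_on sq {0..<int p}"
    by (intro inj_on_iff_surj[THEN iffD2] finite_surj_inj) auto
  moreover have "sq (int p - 1) = sq 1"
  proof -
    have "(int p - 1)\<^sup>2 = 1 + int p * (int p - 2)" by (simp add: power2_eq_square algebra_simps)
    then show ?thesis by (simp add: sq_def)
  qed
  moreover have "int p - 1 \<in> {0..<int p}" "1 \<in> {0..<int p}" using assms(2) by simp_all
  ultimately have "int p - 1 = 1" by (rule inj_onD)
  then show False using assms(2) by simp
qed

section \<open>Incomplete sums of periodic functions\<close>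

lemma bij_betw_mod_interval:
  fixes a Q :: int
  assumes "Q > 0"
  shows "bij_betw (\<lambda>u. u mod Q) {a..<a+Q} {0..<Q}"
proof (rule bij_betw_byWitness[where f' = "\<lambda>w. a + (w - a) mod Q"])
  show "\<forall>u\<in>{a..<a+Q}. a + (u mod Q - a) mod Q = u"
    by (simp add: mod_diff_left_eq)
  show "\<forall>w\<in>{0..<Q}. (a + (w - a) mod Q) mod Q = w"
    by (simp add: mod_add_right_eq)
qed (use assms in auto)

lemma sum_periodic_blocks:
  fixes \<phi> :: "int \<Rightarrow> int" and Q :: nat
  assumes "Q > 0" and per: "\<And>u u'. [u = u'] (mod int Q) \<Longrightarrow> \<phi> u = \<phi> u'"
  shows "(\<Sum>u\<in>{a..<a + int k * int Q}. \<phi> u) = int k * (\<Sum>u\<in>{0..<int Q}. \<phi> u)"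
proof (induction k)
  case (Suc k)
  let ?b = "a + int k * int Q"
  have "a + int (Suc k) * int Q = ?b + int Q" by (simp add: algebra_simps)
  then have "{a..<a + int (Suc k) * int Q} = {a..<?b} \<union> {?b..<?b + int Q}"
    by (simp only:) (simp add: ivl_disj_un_two(3))
  then have "(\<Sum>u\<in>{a..<a + int (Suc k) * int Q}. \<phi> u)
     = (\<Sum>u\<in>{a..<?b}. \<phi> u) + (\<Sum>u\<in>{?b..<?b + int Q}. \<phi> u)"
    by (simp add: sum.union_disjoint)
  also have "(\<Sum>u\<in>{?b..<?b + int Q}. \<phi> u) = (\<Sum>u\<in>{?b..<?b + int Q}. \<phi> (u mod int Q))"
    by (intro sum.cong refl per) (simp add: cong_def)
  also have "\<dots> = (\<Sum>u\<in>{0..<int Q}. \<phi> u)"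
    using assms(1) by (intro sum.reindex_bij_betw bij_betw_mod_interval) simp
  finally show ?case using Suc by (simp add: algebra_simps)
qed simp

text \<open>Complete periods are summed exactly; the fewer than \<open>Q\<close> leftover terms cost
  at most \<open>M\<close> each.\<close>

lemma sum_periodic_approx:
  fixes \<phi> :: "int \<Rightarrow> int" and Q X :: nat
  assumes "Q > 0" and per: "\<And>u u'. [u = u'] (mod int Q) \<Longrightarrow> \<phi> u = \<phi> u'"
    and bound: "\<And>u. \<bar>\<phi> u\<bar> \<le> M"
  shows "\<bar>(\<Sum>u\<in>{a..<a + int X}. \<phi> u) - int (X div Q) * (\<Sum>u\<in>{0..<int Q}. \<phi> u)\<bar> \<le> int Q * M"
proof -
  have "M \<ge> 0" using bound[of 0] by simp
  let ?b = "a + int (X div Q) * int Q"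
  have X: "int X = int (X div Q) * int Q + int (X mod Q)"
    by (metis div_mult_mod_eq of_nat_add of_nat_mult)
  then have "{a..<a + int X} = {a..<?b} \<union> {?b..<a + int X}"
    by (simp add: ivl_disj_un_two(3))
  then have "(\<Sum>u\<in>{a..<a + int X}. \<phi> u) = (\<Sum>u\<in>{a..<?b}. \<phi> u) + (\<Sum>u\<in>{?b..<a + int X}. \<phi> u)"
    by (metis sum.union_disjoint finite_atLeastLessThan_int ivl_disj_int_two(3))
  moreover have "\<bar>\<Sum>u\<in>{?b..<a + int X}. \<phi> u\<bar> \<le> of_nat (card {?b..<a + int X}) * M"
    using sum_abs[of \<phi> "{?b..<a + int X}"] sum_bounded_above[of "{?b..<a + int X}" "\<lambda>u. \<bar>\<phi> u\<bar>" M] bound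
    by (meson order_trans)
  moreover have "int (card {?b..<a + int X}) * M \<le> int Q * M"
    using X assms(1) \<open>M \<ge> 0\<close> by (intro mult_right_mono) (auto simp: less_imp_le)
  ultimately show ?thesis by (simp add: sum_periodic_blocks[OF assms(1) per])
qed

text \<open>Replacing the inner sum by \<open>Y div Q\<close> complete periods costs at most
  \<open>Q\<close> for each of the \<open>X\<close> values of u. The complete inner sums are
  periodic in u, bounded by \<open>Q\<close>, and add up to 0 over a period, so they contribute at
  most \<open>(Y div Q) * Q\<^sup>2 \<le> Y * Q\<close>.\<close>

lemma abs_sum_periodic_le:
  fixes g :: "int \<Rightarrow> int \<Rightarrow> int" and Q X Y :: nat
  assumes "Q > 0"
    and per: "\<And>u u' v v'. [u = u'] (mod int Q) \<Longrightarrow> [v = v'] (mod int Q) \<Longrightarrow> g u v = g u' v'"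
    and bound: "\<And>u v. \<bar>g u v\<bar> \<le> 1"
    and zero: "(\<Sum>u\<in>{0..<int Q}. \<Sum>v\<in>{0..<int Q}. g u v) = 0"
  shows "\<bar>\<Sum>u\<in>{a..<a + int X}. \<Sum>v\<in>{b..<b + int Y}. g u v\<bar> \<le> int (Q * (X + Y))"
proof -
  define G where "G = (\<lambda>u. \<Sum>v\<in>{b..<b + int Y}. g u v)"
  define H where "H = (\<lambda>u. \<Sum>v\<in>{0..<int Q}. g u v)"
  have GH: "\<bar>G u - int (Y div Q) * H u\<bar> \<le> int Q" for u
    using sum_periodic_approx[of Q "g u" 1 b Y] assms(1) per[of u u] bound
    by (simp add: G_def H_def)
  have "\<bar>H u\<bar> \<le> int Q" for u
  proof -
    have "(\<Sum>v\<in>{0..<int Q}. \<bar>g u v\<bar>) \<le> int Q"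
      using sum_bounded_above[of "{0..<int Q}" "\<lambda>v. \<bar>g u v\<bar>" 1] bound by simp
    then show ?thesis unfolding H_def by (rule order_trans[OF sum_abs])
  qed
  moreover have "H u = H u'" if "[u = u'] (mod int Q)" for u u'
    unfolding H_def by (intro sum.cong refl per that) simp
  ultimately have H: "\<bar>\<Sum>u\<in>{a..<a + int X}. H u\<bar> \<le> int Q * int Q"
    using sum_periodic_approx[of Q H "int Q" a X] assms(1) zero by (simp add: H_def)
  have "(\<Sum>u\<in>{a..<a + int X}. G u) = (\<Sum>u\<in>{a..<a + int X}. G u - int (Y div Q) * H u)
     + int (Y div Q) * (\<Sum>u\<in>{a..<a + int X}. H u)"
    by (simp add: sum_subtractf sum_distrib_left)
  also have "\<bar>\<dots>\<bar> \<le> \<bar>\<Sum>u\<in>{a..<a + int X}. G u - int (Y div Q) * H u\<bar>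
     + int (Y div Q) * \<bar>\<Sum>u\<in>{a..<a + int X}. H u\<bar>"
    by (rule order_trans[OF abs_triangle_ineq]) (simp add: abs_mult)
  also have "\<bar>\<Sum>u\<in>{a..<a + int X}. G u - int (Y div Q) * H u\<bar> \<le> int X * int Q"
    using sum_bounded_above[of "{a..<a + int X}" "\<lambda>u. \<bar>G u - int (Y div Q) * H u\<bar>" "int Q"] GH
    by (intro order_trans[OF sum_abs]) simp
  also have "int (Y div Q) * \<bar>\<Sum>u\<in>{a..<a + int X}. H u\<bar> \<le> int (Y div Q) * (int Q * int Q)"
    using H by (intro mult_left_mono) auto
  also have "\<dots> \<le> int Y * int Q"
  proof -
    have "(Y div Q) * Q * Q \<le> Y * Q" by (intro mult_right_mono) auto
    then show ?thesis by (metis mult.assoc of_nat_le_iff of_nat_mult)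
  qed
  finally show ?thesis by (simp add: G_def algebra_simps)
qed

lemma bij_betw_mult_mod:
  fixes l Q :: int
  assumes "coprime l Q" "Q > 0"
  shows "bij_betw (\<lambda>u. l * u mod Q) {0..<Q} {0..<Q}"
proof -
  have "inj_on (\<lambda>u. l * u mod Q) {0..<Q}"
  proof (rule inj_onI)
    fix u v assume uv: "u \<in> {0..<Q}" "v \<in> {0..<Q}" "l * u mod Q = l * v mod Q"
    then have "[u = v] (mod Q)" using assms by (simp add: cong_def[symmetric] cong_mult_lcancel)
    then show "u = v" using uv by (simp add: cong_def)
  qed
  moreover have "(\<lambda>u. l * u mod Q) ` {0..<Q} \<subseteq> {0..<Q}" using assms(2) by auto
  ultimately show ?thesis
    by (simp add: bij_betw_def endo_inj_surj)
qed

text \<open>These are the properties of a form that enter the sieve. They survive an integral linear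
  change of variables, so the locale can be interpreted at the quintic in lattice coordinates
  without expanding it.\<close>

locale odd_form =
  fixes h :: "int \<Rightarrow> int \<Rightarrow> int" and d :: nat
  assumes scale: "h (l * u) (l * v) = l ^ d * h u v" and odd_degree: "odd d"
    and cong: "[u = u'] (mod m) \<Longrightarrow> [v = v'] (mod m) \<Longrightarrow> [h u v = h u' v'] (mod m)"
begin

text \<open>
  Scaling by a number that is a nonresidue modulo one prime and \<open>1\<close> modulo the other flips the
  sign of the summand, because the degree is odd. This replaces the Weil bound.
\<close>

lemma complete_Legendre_sum_eq_0:
  fixes q q' :: nat
  assumes q: "prime q" "q > 2" and q': "prime q'" "q' > 2" and "q \<noteq> q'"
  shows "(\<Sum>u\<in>{0..<int (q * q')}. \<Sum>v\<in>{0..<int (q * q')}.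
    Legendre (k * h u v) q * Legendre (k * h u v) q') = 0"
proof -
  let ?Q = "int (q * q')"
  define g where "g = (\<lambda>u v. Legendre (k * h u v) q * Legendre (k * h u v) q')"
  obtain t where t: "Legendre t q = -1" using exists_nonresidue[OF q] by blast
  have "coprime (int q) (int q')" using q q' \<open>q \<noteq> q'\<close> by (simp add: primes_coprime)
  then obtain l where l: "[l = t] (mod int q)" "[l = 1] (mod int q')"
    using binary_chinese_remainder_int by blast
  have Lq: "Legendre l q = -1" using Legendre_cong[OF l(1)] t by simp
  \<comment> \<open>The value \<open>Legendre 1 q' = 1\<close> is read off from
    \<open>Legendre_power\<close> with exponent 0.\<close>
  have Lq': "Legendre l q' = 1"
    using Legendre_cong[OF l(2)] Legendre_power[OF q', of 1 0] by simp
  have "\<not> int q dvd l" using Lq by (auto simp: Legendre_def cong_0_iff split: if_splits)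
  moreover have "\<not> int q' dvd l" using Lq' by (auto simp: Legendre_def cong_0_iff split: if_splits)
  ultimately have "coprime l ?Q"
    using q q' by (auto simp: coprime_commute[of l] prime_imp_coprime)
  then have bij: "bij_betw (\<lambda>u. l * u mod ?Q) {0..<?Q} {0..<?Q}"
    using q q' by (intro bij_betw_mult_mod) (auto simp: prime_gt_0_nat)
  have per: "g u v = g u' v'" if "[u = u'] (mod ?Q)" "[v = v'] (mod ?Q)" for u u' v v'
  proof -
    have "[k * h u v = k * h u' v'] (mod ?Q)" using that by (intro cong_mult cong) auto
    then have c: "[k * h u v = k * h u' v'] (mod int q)" "[k * h u v = k * h u' v'] (mod int q')"
      by (auto intro: cong_dvd_modulus)
    show ?thesis unfolding g_def Legendre_cong[OF c(1)] Legendre_cong[OF c(2)] ..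
  qed
  have flip: "g (l * u) (l * v) = - g u v" for u v
  proof -
    have "k * h (l * u) (l * v) = l ^ d * (k * h u v)" by (simp add: scale)
    then have "g (l * u) (l * v) = Legendre (l ^ d * (k * h u v)) q * Legendre (l ^ d * (k * h u v)) q'"
      by (simp only: g_def)
    also have "\<dots> = - g u v"
      unfolding Legendre_mult[OF q, of "l ^ d"] Legendre_mult[OF q', of "l ^ d"]
        Legendre_power[OF q] Legendre_power[OF q'] Lq Lq'
      using odd_degree by (simp add: g_def)
    finally show ?thesis .
  qed
  have "(\<Sum>u\<in>{0..<?Q}. \<Sum>v\<in>{0..<?Q}. g u v)
      = (\<Sum>u\<in>{0..<?Q}. \<Sum>v\<in>{0..<?Q}. g (l * u mod ?Q) (l * v mod ?Q))"
    by (subst sum.reindex_bij_betw[OF bij, symmetric], rule sum.cong[OF refl],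
        subst sum.reindex_bij_betw[OF bij, symmetric], rule refl)
  also have "\<dots> = (\<Sum>u\<in>{0..<?Q}. \<Sum>v\<in>{0..<?Q}. - g u v)"
    unfolding flip[symmetric] by (intro sum.cong refl per) (auto simp: cong_def)
  also have "\<dots> = - (\<Sum>u\<in>{0..<?Q}. \<Sum>v\<in>{0..<?Q}. g u v)" by (simp add: sum_negf)
  finally have "(\<Sum>u\<in>{0..<?Q}. \<Sum>v\<in>{0..<?Q}. g u v) = 0" by linarith
  then show ?thesis by (simp add: g_def)
qed

lemma abs_Legendre_sum_le:
  fixes q q' :: nat
  assumes q: "prime q" "q > 2" and q': "prime q'" "q' > 2" and "q \<noteq> q'"
  shows "\<bar>\<Sum>u\<in>{a..<a + int X}. \<Sum>v\<in>{b..<b + int Y}.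
    Legendre (k * h u v) q * Legendre (k * h u v) q'\<bar> \<le> int (q * q' * (X + Y))"
proof -
  define g where "g = (\<lambda>u v. Legendre (k * h u v) q * Legendre (k * h u v) q')"
  have "q * q' > 0" using q q' by (simp add: prime_gt_0_nat)
  moreover have "g u v = g u' v'"
    if "[u = u'] (mod int (q * q'))" "[v = v'] (mod int (q * q'))" for u u' v v'
  proof -
    have "[k * h u v = k * h u' v'] (mod int (q * q'))" using that by (intro cong_mult cong) auto
    then have c: "[k * h u v = k * h u' v'] (mod int q)" "[k * h u v = k * h u' v'] (mod int q')"
      by (auto intro: cong_dvd_modulus)
    show ?thesis unfolding g_def Legendre_cong[OF c(1)] Legendre_cong[OF c(2)] ..
  qed
  moreover have "\<bar>g u v\<bar> \<le> 1" for u v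
    by (simp add: g_def Legendre_def)
  moreover have "(\<Sum>u\<in>{0..<int (q * q')}. \<Sum>v\<in>{0..<int (q * q')}. g u v) = 0"
    unfolding g_def by (rule complete_Legendre_sum_eq_0[OF q q' \<open>q \<noteq> q'\<close>])
  ultimately have "\<bar>\<Sum>u\<in>{a..<a + int X}. \<Sum>v\<in>{b..<b + int Y}. g u v\<bar> \<le> int (q * q' * (X + Y))"
    by (rule abs_sum_periodic_le)
  then show ?thesis by (simp only: g_def)
qed

text \<open>At a point of \<open>S\<close> the symbol is 1 for each prime of \<open>P\<close> not
  dividing y, hence for at least half of \<open>P\<close>, so twice the sum of the symbols is at
  least \<open>card P\<close>. Squaring allows the sum over \<open>S\<close> to be extended to the
  whole box by positivity. After expansion the \<open>card P\<close> diagonal terms are at most XY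
  each, and the others are incomplete sums whose complete versions vanish.\<close>

lemma square_sieve:
  fixes P :: "nat set" and X Y B :: nat
  assumes "finite P" and P: "\<And>q. q \<in> P \<Longrightarrow> prime q \<and> q > 2 \<and> q \<le> B"
    and S: "S \<subseteq> {a..<a + int X} \<times> {b..<b + int Y}"
    and sq: "\<And>u v. (u, v) \<in> S \<Longrightarrow> \<exists>y. k * h u v = y\<^sup>2 \<and> 2 * card {q\<in>P. int q dvd y} \<le> card P"
  shows "card S * card P \<le> 4 * (X * Y) + 4 * card P * B\<^sup>2 * (X + Y)"
proof (cases "P = {}")
  case False
  define r where "r = card P"
  have "r > 0" using False \<open>finite P\<close> by (simp add: r_def card_gt_0_iff)
  define L where "L = (\<lambda>q s. Legendre (k * h (fst s) (snd s)) (int q))"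
  define box where "box = {a..<a + int X} \<times> {b..<b + int Y}"
  have [simp]: "finite box" by (simp add: box_def)
  have lower: "int r \<le> 2 * (\<Sum>q\<in>P. L q s)" if "s \<in> S" for s
  proof -
    have "(fst s, snd s) \<in> S" using that by simp
    then obtain y where y: "k * h (fst s) (snd s) = y\<^sup>2" "2 * card {q\<in>P. int q dvd y} \<le> card P"
      using sq by blast
    have "L q s = (if int q dvd y then 0 else 1)" if "q \<in> P" for q
    proof (cases "int q dvd y")
      case True
      then have "[y\<^sup>2 = 0] (mod int q)" by (simp add: cong_0_iff power2_eq_square)
      then show ?thesis using True by (simp add: L_def y(1) Legendre_def)
    next
      case False
      then show ?thesis using P[OF that] Legendre_square[of q y] unfolding L_def y(1) by simp
    qed
    then have "(\<Sum>q\<in>P. L q s) = (\<Sum>q\<in>P. if int q dvd y then 0 else 1)" by simp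
    also have "\<dots> = (\<Sum>q\<in>{q\<in>P. \<not> int q dvd y}. 1)"
      using \<open>finite P\<close> by (intro sum.mono_neutral_cong_right) auto
    also have "\<dots> = int (card {q\<in>P. \<not> int q dvd y})" by simp
    finally have "(\<Sum>q\<in>P. L q s) = int (card {q\<in>P. \<not> int q dvd y})" .
    moreover have "card {q\<in>P. int q dvd y} + card {q\<in>P. \<not> int q dvd y} = r"
      unfolding r_def using \<open>finite P\<close>
      by (subst card_Un_disjoint[symmetric]) (auto intro!: arg_cong[where f = card])
    ultimately show ?thesis using y(2) r_def by linarith
  qed
  have "int (card S) * (int r)\<^sup>2 = (\<Sum>s\<in>S. (int r)\<^sup>2)" by simp
  also have "\<dots> \<le> (\<Sum>s\<in>S. (2 * (\<Sum>q\<in>P. L q s))\<^sup>2)"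
    by (intro sum_mono power_mono lower) auto
  also have "\<dots> \<le> (\<Sum>s\<in>box. (2 * (\<Sum>q\<in>P. L q s))\<^sup>2)"
    using S by (intro sum_mono2) (auto simp: box_def)
  also have "\<dots> = 4 * (\<Sum>s\<in>box. \<Sum>q\<in>P. \<Sum>q'\<in>P. L q s * L q' s)"
    unfolding power_mult_distrib sum_distrib_left[symmetric] power2_eq_square[of "sum _ _"] sum_product by simp
  also have "(\<Sum>s\<in>box. \<Sum>q\<in>P. \<Sum>q'\<in>P. L q s * L q' s) = (\<Sum>q\<in>P. \<Sum>q'\<in>P. \<Sum>s\<in>box. L q s * L q' s)"
    by (subst sum.swap, rule sum.cong[OF refl], rule sum.swap)
  \<comment> \<open>The off-diagonal bound is granted to the diagonal as well, so that the double
    sum is easy to evaluate.\<close>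
  also have "\<dots> \<le> (\<Sum>q\<in>P. \<Sum>q'\<in>P. (if q = q' then int (X * Y) else 0) + int (B\<^sup>2 * (X + Y)))"
  proof (intro sum_mono)
    fix q q' assume q: "q \<in> P" and q': "q' \<in> P"
    show "(\<Sum>s\<in>box. L q s * L q' s) \<le> (if q = q' then int (X * Y) else 0) + int (B\<^sup>2 * (X + Y))"
    proof (cases "q = q'")
      case True
      have "L q s * L q' s \<le> 1" for s by (simp add: L_def Legendre_def)
      then have "(\<Sum>s\<in>box. L q s * L q' s) \<le> int (card box)"
        using sum_bounded_above[of box "\<lambda>s. L q s * L q' s" 1] by simp
      moreover have "int (card box) = int (X * Y)" by (simp add: box_def)
      moreover have "0 \<le> int (B\<^sup>2 * (X + Y))" by simp
      ultimately have "(\<Sum>s\<in>box. L q s * L q' s) \<le> int (X * Y) + int (B\<^sup>2 * (X + Y))" by linarith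
      then show ?thesis using True by simp
    next
  
      case False
      have "prime q" "q > 2" "prime q'" "q' > 2" using P[OF q] P[OF q'] by auto
      then have *: "\<bar>\<Sum>u\<in>{a..<a + int X}. \<Sum>v\<in>{b..<b + int Y}.
         Legendre (k * h u v) q * Legendre (k * h u v) q'\<bar> \<le> int (q * q' * (X + Y))"
        using False by (intro abs_Legendre_sum_le)
      have "(\<Sum>s\<in>box. L q s * L q' s) = (\<Sum>u\<in>{a..<a + int X}. \<Sum>v\<in>{b..<b + int Y}.
         Legendre (k * h u v) q * Legendre (k * h u v) q')"
        by (simp add: box_def L_def sum.cartesian_product case_prod_beta)
      also have "\<dots> \<le> int (q * q' * (X + Y))"
        using * by linarith
      also have "\<dots> \<le> int (B\<^sup>2 * (X + Y))"
        unfolding power2_eq_square using P[OF q] P[OF q'] by (intro of_nat_mono mult_right_mono mult_mono) auto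
      finally show ?thesis using False by simp
    qed
  qed
  also have "\<dots> = int (r * (X * Y) + r\<^sup>2 * (B\<^sup>2 * (X + Y)))"
    using \<open>finite P\<close> by (simp add: sum.distrib r_def power2_eq_square) (simp add: algebra_simps)
  finally have "int (card S * r\<^sup>2) \<le> int (4 * (r * (X * Y) + r\<^sup>2 * (B\<^sup>2 * (X + Y))))" by simp
  then have "card S * r\<^sup>2 \<le> 4 * (r * (X * Y) + r\<^sup>2 * (B\<^sup>2 * (X + Y)))" by (simp only: of_nat_le_iff)
  then have "r * (card S * r) \<le> r * (4 * (X * Y) + 4 * r * B\<^sup>2 * (X + Y))"
    by (simp add: power2_eq_square algebra_simps)
  then show ?thesis using \<open>r > 0\<close> by (simp add: r_def)
qed simp

end

subsection \<open>Congruence lattices\<close>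

text \<open>Thue's lemma: a square grid with \<open>floor_sqrt m + 1\<close> points per side has
  more than \<open>m\<close> points, so x - rz takes the same value modulo \<open>m\<close> at two
  of them, and their difference is the vector.\<close>

lemma exists_short_lattice_vector:
  fixes m :: nat and r :: int
  assumes "m > 0"
  obtains a b :: int where "(a, b) \<noteq> (0, 0)" "int m dvd a - r * b" "a\<^sup>2 \<le> int m" "b\<^sup>2 \<le> int m"
proof -
  define s where "s = floor_sqrt m"
  have s: "s\<^sup>2 \<le> m" "m < (Suc s)\<^sup>2"
    by (simp_all add: s_def floor_sqrt_power2_le Suc_floor_sqrt_power2_gt)
  define box where "box = {0..int s} \<times> {0..int s}"
  define \<phi> where "\<phi> = (\<lambda>(x, z). (x - r * z) mod int m)"
  have "\<not> inj_on \<phi> box"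
  proof
    assume "inj_on \<phi> box"
    moreover have "\<phi> ` box \<subseteq> {0..<int m}" using assms by (auto simp: \<phi>_def)
    ultimately have "card box \<le> card {0..<int m}" by (intro card_inj_on_le[of \<phi>]) auto
    moreover have "card box = Suc s * Suc s" by (simp add: box_def nat_add_distrib)
    ultimately show False using s(2) by (simp add: power2_eq_square)
  qed
  then obtain x z x' z' where *: "(x, z) \<in> box" "(x', z') \<in> box" "(x, z) \<noteq> (x', z')"
    "(x - r * z) mod int m = (x' - r * z') mod int m"
    by (auto simp: inj_on_def \<phi>_def)
  have sq: "t\<^sup>2 \<le> int m" if "\<bar>t\<bar> \<le> int s" for t
  proof -
    have "t\<^sup>2 \<le> (int s)\<^sup>2" using that by (simp add: abs_le_square_iff[symmetric])
    also have "\<dots> \<le> int m" using s(1) by (metis of_nat_le_iff of_nat_power)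
    finally show ?thesis .
  qed
  show thesis
  proof (rule that)
    show "(x - x', z - z') \<noteq> (0, 0)" using *(3) by auto
    have "int m dvd (x - r * z) - (x' - r * z')" using *(4) by (simp add: mod_eq_dvd_iff)
    then show "int m dvd (x - x') - r * (z - z')" by (simp add: algebra_simps)
  qed (use *(1,2) in \<open>auto simp: box_def intro!: sq\<close>)
qed

text \<open>Integer pairs (k, b) parametrize the lattice by x = rb + mk, z = b. Dividing the short
  vector by the gcd of its parameters makes it primitive in the lattice, and Bezout coefficients
  complete it to a basis.\<close>

lemma exists_lattice_basis:
  fixes m :: nat and r :: int
  assumes "m > 0"
  obtains a b c e :: int where "a * e - b * c = int m" "int m dvd a - r * b" "int m dvd c - r * e"
    "a\<^sup>2 \<le> int m" "b\<^sup>2 \<le> int m"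
proof -
  obtain a b where ab: "(a, b) \<noteq> (0, 0)" "int m dvd a - r * b" "a\<^sup>2 \<le> int m" "b\<^sup>2 \<le> int m"
    using exists_short_lattice_vector[OF assms] .
  then obtain k where k: "a - r * b = int m * k" by (auto simp: dvd_def)
  define g where "g = gcd k b"
  have "g \<noteq> 0" using ab(1) k by (auto simp: g_def)
  then obtain k1 b1 where kb: "k = k1 * g" "b = b1 * g" "coprime k1 b1"
    unfolding g_def using gcd_coprime_exists by blast
  define a1 where "a1 = r * b1 + int m * k1"
  have "a = a1 * g" using k kb by (simp add: a1_def algebra_simps)
  have sq: "t\<^sup>2 \<le> (t * g)\<^sup>2" for t
  proof -
    have "t\<^sup>2 * 1 \<le> t\<^sup>2 * g\<^sup>2"
      using \<open>g \<noteq> 0\<close> by (intro mult_left_mono) (auto simp: int_one_le_iff_zero_less)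
    then show ?thesis by (simp add: power_mult_distrib)
  qed
  obtain u v where "u * k1 + v * b1 = 1"
    using kb(3) bezout_int[of k1 b1] by auto
  then have "a1 * u - b1 * (r * u - int m * v) = int m"
    by (simp add: a1_def algebra_simps) (metis distrib_left mult.commute mult.left_commute mult_1)
  then show thesis
  proof (rule that)
    show "a1\<^sup>2 \<le> int m" using sq[of a1] ab(3) \<open>a = a1 * g\<close> by simp
    show "b1\<^sup>2 \<le> int m" using sq[of b1] ab(4) kb by simp
  qed (auto simp: a1_def)
qed

text \<open>
  Reducing the second basis vector in the coordinate where the first one is largest bounds the
  coordinates of lattice points with respect to the basis.
\<close>

lemma lattice_coordinates_bound:
  fixes a b c e :: int and m :: nat
  assumes det: "\<bar>a * e - b * c\<bar> = int m" and "m > 0" and ba: "\<bar>b\<bar> \<le> \<bar>a\<bar>" and am: "a\<^sup>2 \<le> int m"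
  obtains t where "\<And>u v x z N. x = u * a + v * (c + t * a) \<Longrightarrow> z = u * b + v * (e + t * b) \<Longrightarrow>
     \<bar>x\<bar> \<le> N \<Longrightarrow> \<bar>z\<bar> \<le> N \<Longrightarrow> \<bar>u\<bar> * \<bar>a\<bar> \<le> 2 * N \<and> \<bar>v\<bar> * int m \<le> 2 * \<bar>a\<bar> * N"
proof -
  have "a \<noteq> 0" using assms by auto
  obtain t where t: "2 * \<bar>c + t * a\<bar> \<le> \<bar>a\<bar>"
  proof -
    define A where "A = \<bar>a\<bar>"
    \<comment> \<open>A nearest integer to c/A, so the remainder is at most A/2 in absolute value;
      the sign of \<open>a\<close> is put back through \<open>sgn a\<close>.\<close>
    define q where "q = (2 * c + A) div (2 * A)"
    have "A > 0" using \<open>a \<noteq> 0\<close> by (simp add: A_def)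
    define s where "s = (2 * c + A) mod (2 * A)"
    have "2 * c + A = 2 * (q * A) + s"
      using mult_div_mod_eq[of "2 * A" "2 * c + A"] by (simp add: q_def s_def mult_ac)
    moreover have "0 \<le> s" "s < 2 * A"
      using \<open>A > 0\<close> by (simp_all add: s_def)
    ultimately have "2 * \<bar>c - q * A\<bar> \<le> A" by (simp add: abs_if)
    moreover have "c - q * A = c + (- q * sgn a) * a" by (simp add: A_def abs_sgn mult.assoc mult.commute)
    ultimately show thesis using that[of "- q * sgn a"] unfolding A_def by metis
  qed
  show thesis
  proof (rule that[of t])
    fix u v x z N
    assume x: "x = u * a + v * (c + t * a)" and z: "z = u * b + v * (e + t * b)"
      and N: "\<bar>x\<bar> \<le> N" "\<bar>z\<bar> \<le> N"
    have "N \<ge> 0" using N by linarith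
    \<comment> \<open>Cramer's rule; the shift by \<open>t\<close> does not change the
      determinant.\<close>
    have "v * (a * e - b * c) = a * z - b * x" by (simp add: x z algebra_simps)
    then have "\<bar>v\<bar> * int m = \<bar>a * z - b * x\<bar>" using det by (metis abs_mult)
    also have "\<dots> \<le> \<bar>a\<bar> * \<bar>z\<bar> + \<bar>b\<bar> * \<bar>x\<bar>"
      using abs_triangle_ineq4[of "a * z" "b * x"] by (simp add: abs_mult)
    also have "\<dots> \<le> \<bar>a\<bar> * N + \<bar>a\<bar> * N"
      using N ba by (intro add_mono mult_mono) auto
    finally have v: "\<bar>v\<bar> * int m \<le> 2 * \<bar>a\<bar> * N" by (simp add: mult_ac)
    \<comment> \<open>Since a^2 \<le> m, the bound for v gives |v||a| \<le> 2N. The reduced c + ta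
      is at most |a|/2, so it moves x by at most N.\<close>
    have "(\<bar>v\<bar> * \<bar>a\<bar>) * \<bar>a\<bar> = \<bar>v\<bar> * a\<^sup>2" by (simp add: power2_eq_square mult.assoc)
    also have "\<dots> \<le> \<bar>v\<bar> * int m" using am by (intro mult_left_mono) auto
    also have "\<dots> \<le> (2 * N) * \<bar>a\<bar>" using v by (simp add: algebra_simps)
    finally have va: "\<bar>v\<bar> * \<bar>a\<bar> \<le> 2 * N" using \<open>a \<noteq> 0\<close> by simp
    have "u * a = x - v * (c + t * a)" by (simp add: x)
    then have "\<bar>u\<bar> * \<bar>a\<bar> \<le> \<bar>x\<bar> + \<bar>v\<bar> * \<bar>c + t * a\<bar>"
      using abs_triangle_ineq4[of x "v * (c + t * a)"] by (simp only: abs_mult[symmetric])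
    then have "2 * (\<bar>u\<bar> * \<bar>a\<bar>) \<le> 2 * \<bar>x\<bar> + \<bar>v\<bar> * (2 * \<bar>c + t * a\<bar>)"
      by simp
    also have "\<bar>v\<bar> * (2 * \<bar>c + t * a\<bar>) \<le> \<bar>v\<bar> * \<bar>a\<bar>" using t by (intro mult_left_mono) auto
    finally have "\<bar>u\<bar> * \<bar>a\<bar> \<le> 2 * N" using va N by linarith
    with v show "\<bar>u\<bar> * \<bar>a\<bar> \<le> 2 * N \<and> \<bar>v\<bar> * int m \<le> 2 * \<bar>a\<bar> * N" by simp
  qed
qed

text \<open>\<open>l\<close> is the sup norm of the short basis vector. Either of its coordinates
  may be the larger one; exchanging the coordinates flips the sign of the determinant, so the
  preceding bound is stated with the absolute value.\<close>

lemma exists_reduced_lattice_basis: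
  fixes m :: nat and r :: int
  assumes "m > 0"
  obtains a b c e :: int and l :: nat
  where "int m dvd a - r * b" "int l = max \<bar>a\<bar> \<bar>b\<bar>" "l > 0" "l\<^sup>2 \<le> m"
    "\<And>x z. int m dvd x - r * z \<Longrightarrow> \<exists>u v. x = u * a + v * c \<and> z = u * b + v * e \<and>
      (\<forall>N. \<bar>x\<bar> \<le> N \<longrightarrow> \<bar>z\<bar> \<le> N \<longrightarrow> \<bar>u\<bar> * int l \<le> 2 * N \<and> \<bar>v\<bar> * int m \<le> 2 * int l * N)"
proof -
  obtain a b c e where B: "a * e - b * c = int m" "int m dvd a - r * b" "int m dvd c - r * e"
    "a\<^sup>2 \<le> int m" "b\<^sup>2 \<le> int m"
    using exists_lattice_basis[OF assms] .
  define l where "l = nat (max \<bar>a\<bar> \<bar>b\<bar>)"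
  have l: "int l = max \<bar>a\<bar> \<bar>b\<bar>" by (simp add: l_def)
  obtain t where t: "\<And>u v x z N. x = u * a + v * (c + t * a) \<Longrightarrow> z = u * b + v * (e + t * b) \<Longrightarrow>
     \<bar>x\<bar> \<le> N \<Longrightarrow> \<bar>z\<bar> \<le> N \<Longrightarrow> \<bar>u\<bar> * int l \<le> 2 * N \<and> \<bar>v\<bar> * int m \<le> 2 * int l * N"
  proof (cases "\<bar>b\<bar> \<le> \<bar>a\<bar>")
    case True
    then have "int l = \<bar>a\<bar>" using l by simp
    moreover have "\<bar>a * e - b * c\<bar> = int m" using B(1) by simp
    ultimately show thesis
      using lattice_coordinates_bound[of a e b c m] True B(4) assms that by metis
  next
    case False
    then have "int l = \<bar>b\<bar>" using l by simp
    moreover have "\<bar>b * c - a * e\<bar> = int m" using B(1) by simp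
    moreover have "\<bar>a\<bar> \<le> \<bar>b\<bar>" using False by simp
    ultimately show thesis
      using lattice_coordinates_bound[of b c a e m] B(5) assms that by metis
  qed
  show thesis
  proof (rule that[OF B(2) l])
    have "a \<noteq> 0 \<or> b \<noteq> 0" using B(1) assms by auto
    then show "l > 0" by (auto simp: l_def)
    have "(int l)\<^sup>2 \<le> int m" using B(4,5) l by (simp add: max_def)
    then show "l\<^sup>2 \<le> m" by (metis of_nat_le_iff of_nat_power)
    fix x z assume "int m dvd x - r * z"
    then obtain k where k: "x - r * z = int m * k" by (auto simp: dvd_def)
    obtain k1 where k1: "a - r * b = int m * k1" using B(2) by (auto simp: dvd_def)
    obtain k2 where k2: "c - r * e = int m * k2" using B(3) by (auto simp: dvd_def)
    \<comment> \<open>Cramer's rule in the parameters (k, z), with respect to which the basis has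
      determinant 1.\<close>
    define v where "v = k1 * z - k * b"
    define u where "u = k * e - k2 * z"
    have det: "k1 * e - k2 * b = 1"
    proof -
      have "int m * (k1 * e - k2 * b) = (a - r * b) * e - (c - r * e) * b"
        unfolding k1 k2 by (simp add: algebra_simps)
      also have "\<dots> = int m * 1" using B(1) by (simp add: algebra_simps)
      finally show ?thesis using assms by (metis mult_cancel_left of_nat_0_eq_iff not_gr_zero)
    qed
    have "u * b + v * e = (k1 * e - k2 * b) * z" by (simp add: u_def v_def algebra_simps)
    then have z: "z = u * b + v * e" using det by simp
    have "u * k1 + v * k2 = (k1 * e - k2 * b) * k" by (simp add: u_def v_def algebra_simps)
    then have "k = u * k1 + v * k2" using det by simp
    then have "x = r * z + u * (int m * k1) + v * (int m * k2)"
      using k by (simp add: algebra_simps)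
    then have x: "x = u * a + v * c"
      unfolding k1[symmetric] k2[symmetric] z by (simp add: algebra_simps)
    show "\<exists>u v. x = u * a + v * (c + t * a) \<and> z = u * b + v * (e + t * b) \<and>
      (\<forall>N. \<bar>x\<bar> \<le> N \<longrightarrow> \<bar>z\<bar> \<le> N \<longrightarrow> \<bar>u\<bar> * int l \<le> 2 * N \<and> \<bar>v\<bar> * int m \<le> 2 * int l * N)"
    proof (intro exI conjI)
      show x': "x = (u - v * t) * a + v * (c + t * a)" and z': "z = (u - v * t) * b + v * (e + t * b)"
        by (simp_all add: x z algebra_simps)
      show "\<forall>N. \<bar>x\<bar> \<le> N \<longrightarrow> \<bar>z\<bar> \<le> N \<longrightarrow>
          \<bar>u - v * t\<bar> * int l \<le> 2 * N \<and> \<bar>v\<bar> * int m \<le> 2 * int l * N"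
        using t[OF x' z'] by blast
    qed
  qed
qed

section \<open>Primitive lattice points in a box\<close>

lemma card_int_interval_le:
  assumes "t \<ge> (1 :: real)"
  shows "finite {u :: int. \<bar>real_of_int u\<bar> \<le> t}" "real (card {u :: int. \<bar>real_of_int u\<bar> \<le> t}) \<le> 3 * t"
proof -
  have eq: "{u :: int. \<bar>real_of_int u\<bar> \<le> t} = {-\<lfloor>t\<rfloor>..\<lfloor>t\<rfloor>}"
    by (auto simp: abs_le_iff le_floor_iff) linarith+
  show "finite {u :: int. \<bar>real_of_int u\<bar> \<le> t}" unfolding eq by simp
  have "real (card {-\<lfloor>t\<rfloor>..\<lfloor>t\<rfloor>}) = 2 * of_int \<lfloor>t\<rfloor> + 1" using assms by simp
  also have "\<dots> \<le> 3 * t" using assms of_int_floor_le[of t] by linarith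
  finally show "real (card {u :: int. \<bar>real_of_int u\<bar> \<le> t}) \<le> 3 * t" unfolding eq .
qed

text \<open>If m > 2lN, the second coordinate vanishes and a primitive point is plus or minus the
  short basis vector; this is the term 2. Otherwise U, V \<ge> 1 and the coordinate box has at most
  (3U)(3V) = 36 N^2/m points.\<close>

lemma card_primitive_lattice_points_le:
  fixes m N :: nat and r :: int
  assumes "m > 0"
  defines "A \<equiv> {(x :: int, z :: int). \<bar>x\<bar> \<le> int N \<and> \<bar>z\<bar> \<le> int N \<and> gcd x z = 1 \<and> int m dvd x - r * z}"
  shows "real (card A) \<le> 2 + 36 * (real N)\<^sup>2 / real m"
proof -
  obtain a b c e :: int and l :: nat where B: "int l = max \<bar>a\<bar> \<bar>b\<bar>" "l > 0" "l\<^sup>2 \<le> m"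
    "\<And>x z. int m dvd x - r * z \<Longrightarrow> \<exists>u v. x = u * a + v * c \<and> z = u * b + v * e \<and>
      (\<forall>N. \<bar>x\<bar> \<le> N \<longrightarrow> \<bar>z\<bar> \<le> N \<longrightarrow> \<bar>u\<bar> * int l \<le> 2 * N \<and> \<bar>v\<bar> * int m \<le> 2 * int l * N)"
    using exists_reduced_lattice_basis[OF assms(1), of r] by metis
  have coord: "\<exists>u v. x = u * a + v * c \<and> z = u * b + v * e \<and>
     \<bar>u\<bar> * int l \<le> 2 * int N \<and> \<bar>v\<bar> * int m \<le> 2 * int l * int N" if "(x, z) \<in> A" for x z
    using B(4)[of x z] that by (auto simp: A_def)
  show ?thesis
  proof (cases "m \<le> 2 * l * N")
    case False
    have "A \<subseteq> {(a, b), (-a, -b)}"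
    proof
      fix s assume "s \<in> A"
      then obtain x z where xz: "s = (x, z)" "(x, z) \<in> A" by (cases s) auto
      then obtain u v where uv: "x = u * a + v * c" "z = u * b + v * e" "\<bar>v\<bar> * int m \<le> 2 * int l * int N"
        using coord by blast
      have "2 * int l * int N < int m" using False by (metis not_le of_nat_less_iff of_nat_mult of_nat_numeral)
      then have "\<bar>v\<bar> * int m < 1 * int m" using uv(3) by linarith
      then have "v = 0" using assms(1) by (simp only: mult_less_cancel_right) auto
      then have "u dvd gcd x z" using uv by simp
      moreover have "gcd x z = 1" using xz(2) by (simp add: A_def)
      ultimately have "is_unit u" by metis
      then have "u = 1 \<or> u = -1" by auto
      then show "s \<in> {(a, b), (-a, -b)}" using xz(1) uv \<open>v = 0\<close> by auto
    qed
    then have "card A \<le> 2"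
      using card_mono[of "{(a, b), (-a, -b)}" A] card_insert_le_m1[of 2 "{(-a, -b)}" "(a,b)"] by simp
    moreover have "0 \<le> 36 * (real N)\<^sup>2 / real m" by simp
    ultimately show ?thesis by linarith
  next
    case True
    define U where "U = 2 * real N / real l"
    define V where "V = 2 * real l * real N / real m"
    have "real m \<le> real (2 * l * N)" using True by (simp only: of_nat_le_iff)
    then have "V \<ge> 1" using assms(1) by (simp add: V_def)
    have "l * l \<le> m" using B(3) by (simp only: power2_eq_square)
    also have "\<dots> \<le> (2 * N) * l" using True by (simp only: mult_ac)
    finally have "l * l \<le> (2 * N) * l" .
    then have "l \<le> 2 * N" by (rule mult_right_le_imp_le) (rule B(2))
    then have "real l \<le> real (2 * N)" by (simp only: of_nat_le_iff)
    then have "U \<ge> 1" using B(2) by (simp add: U_def)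
    define W where "W = {u :: int. \<bar>real_of_int u\<bar> \<le> U} \<times> {v :: int. \<bar>real_of_int v\<bar> \<le> V}"
    have "A \<subseteq> (\<lambda>(u, v). (u * a + v * c, u * b + v * e)) ` W"
    proof safe
      fix x z assume "(x, z) \<in> A"
      then obtain u v where uv: "x = u * a + v * c" "z = u * b + v * e"
        "\<bar>u\<bar> * int l \<le> 2 * int N" "\<bar>v\<bar> * int m \<le> 2 * int l * int N"
        using coord by blast
      have "\<bar>real_of_int u\<bar> * real l \<le> 2 * real N"
        using of_int_le_iff[of "\<bar>u\<bar> * int l" "2 * int N", where ?'a = real, THEN iffD2, OF uv(3)] by simp
      moreover have "\<bar>real_of_int v\<bar> * real m \<le> 2 * real l * real N"
        using of_int_le_iff[of "\<bar>v\<bar> * int m" "2 * int l * int N", where ?'a = real, THEN iffD2, OF uv(4)] by simp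
      ultimately have "(u, v) \<in> W"
        using B(2) assms(1) by (simp add: W_def U_def V_def field_simps)
      then show "(x, z) \<in> (\<lambda>(u, v). (u * a + v * c, u * b + v * e)) ` W" using uv by force
    qed
    moreover have "finite W" using card_int_interval_le(1) \<open>U \<ge> 1\<close> \<open>V \<ge> 1\<close> by (simp add: W_def)
    ultimately have "card A \<le> card W" by (rule surj_card_le[rotated])
    also have "real (card W) \<le> (3 * U) * (3 * V)"
      unfolding W_def card_cartesian_product of_nat_mult
      using card_int_interval_le(2) \<open>U \<ge> 1\<close> \<open>V \<ge> 1\<close> by (intro mult_mono) auto
    also have "\<dots> = 36 * (real N)\<^sup>2 / real m"
      using B(2) by (simp add: U_def V_def power2_eq_square field_simps)
    finally show ?thesis by simp
  qed
qed

subsection \<open>Roots of polynomials modulo integers\<close>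

definition roots_mod :: "int poly \<Rightarrow> nat \<Rightarrow> int set" where
  "roots_mod F m = {r \<in> {0..<int m}. int m dvd poly F r}"

lemma finite_roots_mod [simp]: "finite (roots_mod F m)"
  unfolding roots_mod_def by (rule finite_subset[of _ "{0..<int m}"]) auto

lemma poly_cong:
  fixes F :: "int poly"
  assumes "[a = b] (mod m)"
  shows "[poly F a = poly F b] (mod m)"
  by (induction F) (auto intro!: cong_add cong_mult assms)

text \<open>Lagrange's bound: splitting off a linear factor at a root keeps the leading coefficient,
  so the hypothesis passes to the quotient.\<close>

lemma card_roots_mod_prime_le:
  assumes "prime q" "\<not> int q dvd lead_coeff F"
  shows "card (roots_mod F q) \<le> degree F"
  using assms(2)
proof (induction "degree F" arbitrary: F)
  case 0
  then obtain c where "F = [:c:]" by (metis degree_eq_zeroE)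
  then have "roots_mod F q = {}" using 0 by (auto simp: roots_mod_def)
  then show ?case by simp
next
  case (Suc n)
  show ?case
  proof (cases "roots_mod F q = {}")
    case False
    then obtain c where c: "c \<in> roots_mod F q" by blast
    define G where "G = synthetic_div F c"
    have F: "F = [:- c, 1:] * G + [:poly F c:]" unfolding G_def by (rule synthetic_div_correct'[symmetric])
    have dG: "degree G = n" using Suc.hyps(2) by (simp add: G_def degree_synthetic_div)
    have "lead_coeff F = coeff ([:- c, 1:] * G + [:poly F c:]) (Suc n)"
      using F Suc.hyps(2) by metis
    also have "\<dots> = lead_coeff G" using dG by (simp add: coeff_pCons coeff_eq_0)
    finally have "card (roots_mod G q) \<le> n" using Suc.hyps(1)[of G] dG Suc.prems by simp
    moreover have "roots_mod F q \<subseteq> insert c (roots_mod G q)"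
    proof
      fix r assume r: "r \<in> roots_mod F q"
      have "poly F r = (r - c) * poly G r + poly F c" by (subst F) (simp add: algebra_simps)
      then have "int q dvd (r - c) * poly G r"
        using r c by (metis (no_types, lifting) add_diff_cancel_right' dvd_diff mem_Collect_eq roots_mod_def)
      then have "int q dvd r - c \<or> int q dvd poly G r"
        using assms(1) by (simp add: prime_dvd_mult_iff)
      moreover have "r = c" if "int q dvd r - c"
        using that r c by (auto simp: roots_mod_def mod_eq_dvd_iff[symmetric])
      ultimately show "r \<in> insert c (roots_mod G q)" using r by (auto simp: roots_mod_def)
    qed
    ultimately have "card (roots_mod F q) \<le> Suc n"
      using card_mono[of "insert c (roots_mod G q)" "roots_mod F q"]
        card_insert_le_m1[of "Suc n" "roots_mod G q" c] by simp
    then show ?thesis using Suc.hyps(2) by simp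
  qed simp
qed

text \<open>The injectivity in the Chinese remainder theorem.\<close>

lemma card_roots_mod_coprime_mult_le:
  assumes "coprime m n" "m > 0" "n > 0"
  shows "card (roots_mod F (m * n)) \<le> card (roots_mod F m) * card (roots_mod F n)"
proof -
  let ?\<phi> = "\<lambda>r. (r mod int m, r mod int n)"
  have "inj_on ?\<phi> (roots_mod F (m * n))"
  proof (rule inj_onI)
    fix r s assume rs: "r \<in> roots_mod F (m * n)" "s \<in> roots_mod F (m * n)" "?\<phi> r = ?\<phi> s"
    then have "[r = s] (mod int m)" "[r = s] (mod int n)" by (auto simp: cong_def)
    then have "[r = s] (mod int m * int n)"
      using assms(1) by (intro coprime_cong_mult) auto
    then show "r = s" using rs by (auto simp: cong_def roots_mod_def)
  qed
  moreover have "?\<phi> ` roots_mod F (m * n) \<subseteq> roots_mod F m \<times> roots_mod F n"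
  proof -
    have "int k dvd poly F (r mod int k)" if "int k dvd poly F r" for r k
      using that poly_cong[of "r mod int k" r "int k" F] by (simp add: cong_dvd_iff)
    moreover have "int m dvd poly F r" "int n dvd poly F r" if "r \<in> roots_mod F (m * n)" for r
      using that by (auto simp: roots_mod_def intro: dvd_mult_left dvd_mult_right)
    ultimately show ?thesis using assms by (auto simp: roots_mod_def)
  qed
  ultimately show ?thesis
    using card_inj_on_le[of ?\<phi> "roots_mod F (m * n)" "roots_mod F m \<times> roots_mod F n"]
    by (simp add: card_cartesian_product)
qed

lemma squarefree_eq_prod_prime_factors:
  fixes m :: nat
  assumes "squarefree m"
  shows "m = \<Prod>(prime_factors m)"
proof -
  have "m \<noteq> 0" using assms by (metis not_squarefree_0)
  then have "m = (\<Prod>p\<in>prime_factors m. p ^ multiplicity p m)"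
    by (simp add: prime_factorization_nat)
  also have "\<dots> = \<Prod>(prime_factors m)"
  proof (intro prod.cong refl)
    fix p assume p: "p \<in> prime_factors m"
    then have "multiplicity p m \<noteq> 0" "multiplicity p m \<le> 1"
      using assms \<open>m \<noteq> 0\<close> squarefree_factorial_semiring''[of m]
      by (auto simp: prime_factors_multiplicity)
    then show "p ^ multiplicity p m = p" by (simp add: le_Suc_eq)
  qed
  finally show ?thesis .
qed

lemma card_roots_mod_squarefree_le:
  assumes "squarefree m" "coprime (int m) (lead_coeff F)"
  shows "card (roots_mod F m) \<le> degree F ^ card (prime_factors m)"
proof -
  have "card (roots_mod F (\<Prod>A)) \<le> degree F ^ card A"
    if "finite A" "\<And>p. p \<in> A \<Longrightarrow> prime p \<and> \<not> int p dvd lead_coeff F" for A :: "nat set"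
    using that
  proof (induction A rule: finite_induct)
    case empty
    have "roots_mod F 1 \<subseteq> {0}" by (auto simp: roots_mod_def)
    then show ?case using card_mono[of "{0}" "roots_mod F 1"] by simp
  next
    case (insert p A)
    have "coprime p (\<Prod>A)"
      using insert by (intro prod_coprime_right primes_coprime) auto
    moreover have "p > 0" "\<Prod>A > 0" using insert by (auto intro!: prod_pos simp: prime_gt_0_nat)
    ultimately have "card (roots_mod F (p * \<Prod>A)) \<le> card (roots_mod F p) * card (roots_mod F (\<Prod>A))"
      by (rule card_roots_mod_coprime_mult_le)
    also have "\<dots> \<le> degree F * degree F ^ card A"
      using insert by (intro mult_mono card_roots_mod_prime_le) auto
    finally show ?case using insert by simp
  qed
  moreover have "\<not> int p dvd lead_coeff F" if "p \<in> prime_factors m" for p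
  proof
    assume "int p dvd lead_coeff F"
    moreover have "int p dvd int m" using that by auto
    ultimately have "is_unit (int p)" using assms(2) by (meson coprime_def)
    then show False using that by (auto simp: in_prime_factors_iff)
  qed
  ultimately have "card (roots_mod F (\<Prod>(prime_factors m))) \<le> degree F ^ card (prime_factors m)"
    by (metis finite_set_mset in_prime_factors_imp_prime)
  then show ?thesis using squarefree_eq_prod_prime_factors[OF assms(1)] by simp
qed

lemma poly_taylor2:
  fixes F :: "int poly"
  shows "\<exists>k. poly F (r + t) = poly F r + t * poly (pderiv F) r + t\<^sup>2 * k"
proof (induction F)
  case (pCons a F)
  then obtain k where k: "poly F (r + t) = poly F r + t * poly (pderiv F) r + t\<^sup>2 * k" by blast
  show ?case
    by (rule exI[of _ "poly (pderiv F) r + (r + t) * k"])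
      (simp add: k pderiv_pCons algebra_simps power2_eq_square)
qed simp

text \<open>Uniqueness in Hensel's lemma: as \<open>p\<close> does not divide \<open>R\<close>, the
  derivative is a unit at every root, and two roots modulo p^2 that agree modulo p coincide.\<close>

lemma card_roots_mod_prime_square_le:
  assumes "A * F + B * pderiv F = [:R:]" "prime p" "\<not> int p dvd R" "\<not> int p dvd lead_coeff F"
  shows "card (roots_mod F (p\<^sup>2)) \<le> degree F"
proof -
  have "inj_on (\<lambda>r. r mod int p) (roots_mod F (p\<^sup>2))"
  proof (rule inj_onI)
    fix r s assume rs: "r \<in> roots_mod F (p\<^sup>2)" "s \<in> roots_mod F (p\<^sup>2)" "r mod int p = s mod int p"
    define t where "t = s - r"
    have "int p dvd t" using rs(3) by (simp add: t_def mod_eq_dvd_iff dvd_diff_commute)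
    have p2: "(int p)\<^sup>2 dvd poly F r" "(int p)\<^sup>2 dvd poly F s" using rs by (auto simp: roots_mod_def)
    obtain k where "poly F (r + t) = poly F r + t * poly (pderiv F) r + t\<^sup>2 * k"
      using poly_taylor2 by blast
    then have "t * poly (pderiv F) r = poly F s - poly F r - t\<^sup>2 * k" by (simp add: t_def)
    moreover have "(int p)\<^sup>2 dvd t\<^sup>2" using \<open>int p dvd t\<close> by simp
    ultimately have d: "(int p)\<^sup>2 dvd t * poly (pderiv F) r"
      using p2 by (simp add: dvd_diff dvd_mult2)
    have "\<not> int p dvd poly (pderiv F) r"
    proof
      assume "int p dvd poly (pderiv F) r"
      moreover have "int p dvd poly F r" using p2(1) by (meson dvd_power dvd_trans pos2)
      ultimately have "int p dvd poly (A * F + B * pderiv F) r" by simp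
      then show False using assms by simp
    qed
    then have "coprime ((int p)\<^sup>2) (poly (pderiv F) r)"
      using assms(2) by (simp add: prime_imp_coprime)
    then have "(int p)\<^sup>2 dvd t" using d by (simp add: coprime_dvd_mult_left_iff)
    then have "s mod int (p\<^sup>2) = r mod int (p\<^sup>2)" by (simp add: t_def mod_eq_dvd_iff)
    then show "r = s" using rs by (auto simp: roots_mod_def)
  qed
  moreover have "(\<lambda>r. r mod int p) ` roots_mod F (p\<^sup>2) \<subseteq> roots_mod F p"
  proof safe
    fix r assume "r \<in> roots_mod F (p\<^sup>2)"
    then have "(int p)\<^sup>2 dvd poly F r" by (simp add: roots_mod_def)
    then have "int p dvd poly F r" by (meson dvd_power dvd_trans pos2)
    then have "int p dvd poly F (r mod int p)"
      using poly_cong[of "r mod int p" r "int p" F] by (simp add: cong_dvd_iff)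
    then show "r mod int p \<in> roots_mod F p" using assms(2) by (simp add: roots_mod_def prime_gt_0_nat)
  qed
  ultimately have "card (roots_mod F (p\<^sup>2)) \<le> card (roots_mod F p)"
    by (intro card_inj_on_le) auto
  also have "\<dots> \<le> degree F" using assms by (intro card_roots_mod_prime_le)
  finally show ?thesis .
qed

subsection \<open>Divisor bounds\<close>

lemma prod_prime_factors_le:
  fixes n :: nat
  assumes "n > 0"
  shows "\<Prod>(prime_factors n) \<le> n"
proof -
  have "\<Prod>(prime_factors n) \<le> (\<Prod>p\<in>prime_factors n. p ^ multiplicity p n)"
  proof (intro prod_mono conjI)
    fix p assume p: "p \<in> prime_factors n"
    then have "0 < multiplicity p n" "0 < p" by (auto simp: prime_factors_multiplicity prime_gt_0_nat)
    then show "p \<le> p ^ multiplicity p n" by (simp add: self_le_power)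
  qed simp
  also have "\<dots> = n" using assms by (simp add: prime_factorization_nat[symmetric])
  finally show ?thesis .
qed

text \<open>Primes with p^\<epsilon> \<ge> K pay for their own factor K. At most \<open>B\<close>
  primes are too small for that, hence the constant K^B.\<close>

lemma power_card_prime_factors_le:
  fixes K \<epsilon> :: real
  assumes "K \<ge> 1" "\<epsilon> > 0"
  obtains C where "C \<ge> 1" "\<And>n :: nat. n > 0 \<Longrightarrow> K ^ card (prime_factors n) \<le> C * real n powr \<epsilon>"
proof -
  define B where "B = nat \<lceil>K powr (1 / \<epsilon>)\<rceil>"
  have large: "K \<le> real p powr \<epsilon>" if "p \<ge> B" for p
  proof -
    have "K powr (1 / \<epsilon>) \<le> real p" using that by (simp add: B_def nat_le_iff ceiling_le_iff)
    then have "(K powr (1 / \<epsilon>)) powr \<epsilon> \<le> real p powr \<epsilon>" using assms by (intro powr_mono2) auto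
    then show ?thesis using assms by (simp add: powr_powr)
  qed
  have "K ^ card (prime_factors n) \<le> K ^ B * real n powr \<epsilon>" if "n > 0" for n :: nat
  proof -
    let ?A = "prime_factors n"
    have pos: "p > 0" if "p \<in> ?A" for p using that by (metis in_prime_factors_imp_prime prime_gt_0_nat)
    have "K ^ card ?A = (\<Prod>p\<in>?A. K)" by simp
    also have "\<dots> \<le> (\<Prod>p\<in>?A. (if p < B then K else 1) * real p powr \<epsilon>)"
    proof (intro prod_mono conjI)
      fix p assume "p \<in> ?A"
      then have "1 \<le> real p powr \<epsilon>" using pos[of p] assms by (simp add: ge_one_powr_ge_zero)
      then show "K \<le> (if p < B then K else 1) * real p powr \<epsilon>"
        using large[of p] assms by (auto simp: mult_le_cancel_left1)
    qed (use assms in auto)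
    also have "\<dots> = (\<Prod>p\<in>?A. if p < B then K else 1) * (\<Prod>p\<in>?A. real p powr \<epsilon>)"
      by (rule prod.distrib)
    also have "(\<Prod>p\<in>?A. if p < B then K else 1) = (\<Prod>p\<in>{p\<in>?A. p < B}. K)"
      by (intro prod.mono_neutral_cong_right) auto
    also have "\<dots> = K ^ card {p\<in>?A. p < B}" by simp
    also have "(\<Prod>p\<in>?A. real p powr \<epsilon>) = (\<Prod>p\<in>?A. real p) powr \<epsilon>"
      by (rule prod_powr_distrib[symmetric])
    also have "(\<Prod>p\<in>?A. real p) = real (\<Prod>?A)" by simp
    also have "K ^ card {p\<in>?A. p < B} * real (\<Prod>?A) powr \<epsilon> \<le> K ^ B * real n powr \<epsilon>"
    proof (intro mult_mono power_increasing powr_mono2)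
      have "card {p\<in>?A. p < B} \<le> card {..<B}" by (intro card_mono) auto
      then show "card {p\<in>?A. p < B} \<le> B" by simp
    qed (use assms prod_prime_factors_le[OF that] in \<open>auto simp: of_nat_le_iff simp del: of_nat_prod\<close>)
    finally show ?thesis .
  qed
  moreover have "K ^ B \<ge> 1" using assms by simp
  ultimately show thesis using that by blast
qed

lemma two_power_card_prime_factors_le:
  fixes n :: nat
  assumes "n > 0"
  shows "2 ^ card (prime_factors n) \<le> n"
proof -
  have "2 ^ card (prime_factors n) = (\<Prod>p\<in>prime_factors n. 2::nat)" by simp
  also have "\<dots> \<le> \<Prod>(prime_factors n)"
    by (intro prod_mono) (auto dest!: in_prime_factors_imp_prime prime_ge_2_nat)
  also have "\<dots> \<le> n" using prod_prime_factors_le[OF assms] .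
  finally show ?thesis .
qed

text \<open>A squarefree divisor is determined by its set of prime factors.\<close>

lemma card_squarefree_divisors_le:
  fixes n :: nat
  assumes "n > 0"
  shows "finite {m. m dvd n \<and> squarefree m}"
    and "card {m. m dvd n \<and> squarefree m} \<le> 2 ^ card (prime_factors n)"
proof -
  have "{m. m dvd n \<and> squarefree m} \<subseteq> {..n}" using assms by (auto dest: dvd_imp_le)
  then show "finite {m. m dvd n \<and> squarefree m}" by (rule finite_subset) simp
  have "inj_on prime_factors {m. m dvd n \<and> squarefree m}"
    by (rule inj_onI) (metis (mono_tags) mem_Collect_eq squarefree_eq_prod_prime_factors)
  moreover have "prime_factors ` {m. m dvd n \<and> squarefree m} \<subseteq> Pow (prime_factors n)"
    using assms by (auto dest: dvd_prime_factors[rotated])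
  ultimately have "card {m. m dvd n \<and> squarefree m} \<le> card (Pow (prime_factors n))"
    by (intro card_inj_on_le) auto
  then show "card {m. m dvd n \<and> squarefree m} \<le> 2 ^ card (prime_factors n)"
    by (simp add: card_Pow)
qed

subsection \<open>A lower bound for the number of primes\<close>

text \<open>The left side is ln(n!). Each ln k is the sum of \<open>mangoldt\<close> over the
  divisors of k, and d has \<open>n div d\<close> multiples up to n.\<close>

lemma sum_ln_eq_sum_mangoldt:
  "(\<Sum>k\<in>{1..n}. ln (real k)) = (\<Sum>d\<in>{1..n}. mangoldt d * real (n div d))"
proof -
  have multiples: "card {k\<in>{1..n}. d dvd k} = n div d" if "d \<ge> 1" for d
  proof -
    have "{k\<in>{1..n}. d dvd k} = (\<lambda>j. d * j) ` {1..n div d}"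
      using that by (auto simp: less_eq_div_iff_mult_less_eq mult.commute elim!: dvdE)
    then show ?thesis using that by (simp add: card_image inj_on_def)
  qed
  have "(\<Sum>k\<in>{1..n}. ln (real k)) = (\<Sum>k\<in>{1..n}. \<Sum>d\<in>{1..n}. if d dvd k then mangoldt d else 0)"
  proof (intro sum.cong refl)
    fix k assume k: "k \<in> {1..n}"
    have "ln (real k) = (\<Sum>d | d dvd k. mangoldt d)" using mangoldt_sum[of k, where 'a = real] k by simp
    also have "\<dots> = (\<Sum>d\<in>{1..n}. if d dvd k then mangoldt d else 0)"
    proof (intro sum.mono_neutral_cong_left)
      show "{d. d dvd k} \<subseteq> {1..n}"
      proof
        fix d assume "d \<in> {d. d dvd k}"
        then have "d dvd k" by simp
        then show "d \<in> {1..n}" using k dvd_imp_le[of d k] dvd_pos_nat[of k d] by auto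
      qed
    qed auto
    finally show "ln (real k) = (\<Sum>d\<in>{1..n}. if d dvd k then mangoldt d else 0)" .
  qed
  also have "\<dots> = (\<Sum>d\<in>{1..n}. \<Sum>k\<in>{1..n}. if d dvd k then mangoldt d else 0)" by (rule sum.swap)
  also have "\<dots> = (\<Sum>d\<in>{1..n}. mangoldt d * real (n div d))"
  proof (intro sum.cong refl)
    fix d assume d: "d \<in> {1..n}"
    have "(\<Sum>k\<in>{1..n}. if d dvd k then mangoldt d else 0) = (\<Sum>k\<in>{k\<in>{1..n}. d dvd k}. mangoldt d :: real)"
      by (intro sum.mono_neutral_cong_right) auto
    then show "(\<Sum>k\<in>{1..n}. if d dvd k then mangoldt d else 0) = mangoldt d * real (n div d)"
      using multiples[of d] d by simp
  qed
  finally show ?thesis .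
qed

text \<open>Grouped by the underlying prime p: the powers of p up to n contribute ln p each, in
  total at most ln n.\<close>

lemma sum_mangoldt_le:
  assumes "n \<ge> 1"
  shows "(\<Sum>d\<in>{1..n}. mangoldt d) \<le> real (card {p. prime p \<and> p \<le> n}) * ln (real n)"
proof -
  let ?P = "{p. prime p \<and> p \<le> n}"
  let ?D = "{d\<in>{1..n}. primepow d}"
  have fin: "finite ?P" by simp
  have "(\<Sum>d\<in>{1..n}. mangoldt d) = (\<Sum>d\<in>?D. ln (real (aprimedivisor d)))"
    by (intro sum.mono_neutral_cong_right) (auto simp: mangoldt_def)
  also have "\<dots> = (\<Sum>p\<in>?P. \<Sum>d\<in>{d\<in>?D. aprimedivisor d = p}. ln (real (aprimedivisor d)))"
  proof (rule sum.group[symmetric])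
    show "aprimedivisor ` ?D \<subseteq> ?P"
    proof safe
      fix d assume d: "d \<in> {1..n}" "primepow d"
      then have "d > 1" using primepow_gt_Suc_0[of d] by simp
      then show "prime (aprimedivisor d)" by (intro prime_aprimedivisor') auto
      have "aprimedivisor d dvd d" using \<open>d > 1\<close> by (intro aprimedivisor_dvd') auto
      then have "aprimedivisor d \<le> d" using \<open>d > 1\<close> by (simp add: dvd_imp_le)
      then show "aprimedivisor d \<le> n" using d by simp
    qed
  qed auto
  also have "\<dots> \<le> (\<Sum>p\<in>?P. ln (real n))"
  proof (rule sum_mono)
    fix p assume p: "p \<in> ?P"
    then have "p > 1" using prime_gt_1_nat by blast
    define A where "A = {k. 1 \<le> k \<and> p ^ k \<le> n}"
    have "k < p ^ k" for k using \<open>p > 1\<close> by (simp add: power_gt_expt)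
    then have "A \<subseteq> {..n}" by (auto simp: A_def intro: less_imp_le order_trans)
    then have "finite A" by (rule finite_subset) simp
    have "{d\<in>?D. aprimedivisor d = p} \<subseteq> (\<lambda>k. p ^ k) ` A"
    proof safe
      fix d assume d: "d \<in> {1..n}" "primepow d" "p = aprimedivisor d"
      then obtain q k where qk: "prime q" "k > 0" "d = q ^ k" by (auto simp: primepow_def)
      then have "aprimedivisor d = q" by (simp add: aprimedivisor_prime_power)
      then show "d \<in> (\<lambda>k. aprimedivisor d ^ k) ` A" using d qk by (auto simp: A_def)
    qed
    then have "card {d\<in>?D. aprimedivisor d = p} \<le> card A" using \<open>finite A\<close> by (rule surj_card_le[rotated])
    have "(\<Sum>d\<in>{d\<in>?D. aprimedivisor d = p}. ln (real (aprimedivisor d)))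
        = real (card {d\<in>?D. aprimedivisor d = p}) * ln (real p)" by simp
    also have "\<dots> \<le> real (card A) * ln (real p)"
      using \<open>card {d\<in>?D. aprimedivisor d = p} \<le> card A\<close> \<open>p > 1\<close> by (intro mult_right_mono) auto
    also have "\<dots> \<le> ln (real n)"
    proof (cases "A = {}")
      case False
      \<comment> \<open>The number of admissible exponents is at most the largest of them, for which
        p^k \<le> n still holds.\<close>
      have "A \<subseteq> {1..Max A}" using \<open>finite A\<close> by (auto simp: A_def)
      then have "card A \<le> Max A" using card_mono[of "{1..Max A}" A] by simp
      then have "real (card A) * ln (real p) \<le> real (Max A) * ln (real p)"
        using \<open>p > 1\<close> by (intro mult_right_mono) auto
      also have "\<dots> = ln (real (p ^ Max A))" using \<open>p > 1\<close> by (simp add: ln_realpow)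
      also have "\<dots> \<le> ln (real n)"
        using Max_in[OF \<open>finite A\<close> False] \<open>p > 1\<close> assms by (subst ln_le_cancel_iff) (auto simp: A_def)
      finally show ?thesis .
    qed (use assms in auto)
    finally show "(\<Sum>d\<in>{d\<in>?D. aprimedivisor d = p}. ln (real (aprimedivisor d))) \<le> ln (real n)" .
  qed
  finally show ?thesis by simp
qed

text \<open>Chebyshev's argument: the central binomial coefficient is at least 4^n/(2n), and in the
  expansion of its logarithm each \<open>mangoldt d\<close> has a coefficient
  \<open>2 * n div d - 2 * (n div d)\<close> of at most 1.\<close>

lemma chebyshev_lower_bound:
  assumes "n \<ge> 1"
  shows "real n * ln 4 - ln (2 * real n) \<le> real (card {p. prime p \<and> p \<le> 2 * n}) * ln (2 * real n)"
proof -
  have ln_fact: "ln (fact m) = (\<Sum>d\<in>{1..2*n}. mangoldt d * real (m div d))" if "m \<le> 2 * n" for m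
  proof -
    have "ln (fact m :: real) = (\<Sum>k\<in>{1..m}. ln (real k))"
      unfolding fact_prod of_nat_prod by (subst ln_prod) auto
    also have "\<dots> = (\<Sum>d\<in>{1..m}. mangoldt d * real (m div d))" by (rule sum_ln_eq_sum_mangoldt)
    also have "\<dots> = (\<Sum>d\<in>{1..2*n}. mangoldt d * real (m div d))"
      using that by (intro sum.mono_neutral_left) auto
    finally show ?thesis .
  qed
  have "4 ^ n / (2 * real n) \<le> real ((2 * n) choose n)"
    using central_binomial_lower_bound[of n] assms by simp
  then have "ln (4 ^ n / (2 * real n)) \<le> ln (real ((2 * n) choose n))"
    using assms by (subst ln_le_cancel_iff) auto
  moreover have "ln (4 ^ n / (2 * real n)) = real n * ln 4 - ln (2 * real n)"
    using assms by (simp add: ln_div ln_realpow)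
  moreover have "ln (real ((2 * n) choose n)) = ln (fact (2 * n)) - 2 * ln (fact n)"
    by (simp add: binomial_fact ln_div ln_mult)
  ultimately have "real n * ln 4 - ln (2 * real n) \<le> ln (fact (2 * n)) - 2 * ln (fact n)" by simp
  also have "\<dots> = (\<Sum>d\<in>{1..2*n}. mangoldt d * (real (2 * n div d) - 2 * real (n div d)))"
    by (simp add: ln_fact sum_subtractf sum_distrib_left algebra_simps)
  also have "\<dots> \<le> (\<Sum>d\<in>{1..2*n}. mangoldt d * 1)"
  proof (intro sum_mono mult_left_mono mangoldt_nonneg)
    fix d assume "d \<in> {1..2*n}"
    then have "d > 0" by simp
    have "2 * n = 2 * (n div d) * d + 2 * (n mod d)"
      by (metis distrib_left div_mult_mod_eq mult.assoc)
    moreover have "n mod d < d" using \<open>d > 0\<close> by simp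
    ultimately have "2 * n < (2 * (n div d) + 2) * d" by (simp add: algebra_simps)
    then have "2 * n div d < 2 * (n div d) + 2" using \<open>d > 0\<close> by (simp add: div_less_iff_less_mult)
    then show "real (2 * n div d) - 2 * real (n div d) \<le> 1" by simp
  qed
  also have "\<dots> \<le> real (card {p. prime p \<and> p \<le> 2 * n}) * ln (2 * real n)"
    using sum_mangoldt_le[of "2 * n"] assms by simp
  finally show ?thesis .
qed

subsection \<open>Counting lattice points on the forms\<close>

definition primitive_points :: "nat \<Rightarrow> (int \<times> int) set" where
  "primitive_points N = {(x, z). \<bar>x\<bar> \<le> int N \<and> \<bar>z\<bar> \<le> int N \<and> gcd x z = 1}"

definition lattice_points :: "nat \<Rightarrow> nat \<Rightarrow> int \<Rightarrow> (int \<times> int) set" where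
  "lattice_points N m r = {(x, z) \<in> primitive_points N. int m dvd x - r * z}"

lemma finite_primitive_points [simp]: "finite (primitive_points N)"
proof (rule finite_subset)
  show "primitive_points N \<subseteq> {- int N..int N} \<times> {- int N..int N}"
    by (auto simp: primitive_points_def abs_le_iff)
qed simp

lemma finite_lattice_points [simp]: "finite (lattice_points N m r)"
  by (rule finite_subset[of _ "primitive_points N"]) (auto simp: lattice_points_def)

lemma card_lattice_points_le:
  assumes "m > 0"
  shows "real (card (lattice_points N m r)) \<le> 2 + 36 * (real N)\<^sup>2 / real m"
proof -
  have "lattice_points N m r
      = {(x :: int, z :: int). \<bar>x\<bar> \<le> int N \<and> \<bar>z\<bar> \<le> int N \<and> gcd x z = 1 \<and> int m dvd x - r * z}"
    by (auto simp: lattice_points_def primitive_points_def)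
  then show ?thesis using card_primitive_lattice_points_le[OF assms, of N r] by simp
qed

lemma card_UN_le_mult:
  assumes "finite I" "\<And>i. i \<in> I \<Longrightarrow> real (card (f i)) \<le> b"
  shows "real (card (\<Union>i\<in>I. f i)) \<le> real (card I) * b"
proof -
  have "real (card (\<Union>i\<in>I. f i)) \<le> (\<Sum>i\<in>I. real (card (f i)))"
    using card_UN_le[OF assms(1), of f] by (metis of_nat_le_iff of_nat_sum)
  also have "\<dots> \<le> real (card I) * b" using assms(2) by (rule sum_bounded_above)
  finally show ?thesis .
qed

locale irreducible_quintic =
  fixes F :: "int poly"
  assumes irr: "irreducible F" and deg: "degree F = 5"
begin

abbreviation h :: "int \<Rightarrow> int \<Rightarrow> int" where "h \<equiv> binary_form 5 F"

text \<open>A bound for the form on the unit square that also dominates the leading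
  coefficient.\<close>

definition H :: real where "H = of_int (\<Sum>j\<le>5. \<bar>coeff F j\<bar>)"

lemma lead_nonzero: "coeff F 5 \<noteq> 0"
  using deg by (metis degree_0 leading_coeff_0_iff zero_neq_numeral)

lemma H_ge_1: "H \<ge> 1"
proof -
  have "\<bar>coeff F 5\<bar> \<le> (\<Sum>j\<le>5. \<bar>coeff F j\<bar>)" by (intro member_le_sum) auto
  moreover have "\<bar>coeff F 5\<bar> \<ge> 1" using lead_nonzero by simp
  ultimately have "(\<Sum>j\<le>5. \<bar>coeff F j\<bar>) \<ge> 1" by linarith
  then show ?thesis unfolding H_def by (simp only: of_int_1_le_iff)
qed

lemma abs_h_le:
  assumes "\<bar>real_of_int x\<bar> \<le> t" "\<bar>real_of_int z\<bar> \<le> t"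
  shows "\<bar>real_of_int (h x z)\<bar> \<le> H * t ^ 5"
proof -
  define B where "B = max \<bar>x\<bar> \<bar>z\<bar>"
  have "\<bar>h x z\<bar> \<le> (\<Sum>j\<le>5. \<bar>coeff F j\<bar>) * B ^ 5"
    by (rule abs_binary_form_le) (auto simp: B_def)
  then have "real_of_int \<bar>h x z\<bar> \<le> of_int ((\<Sum>j\<le>5. \<bar>coeff F j\<bar>) * B ^ 5)"
    by (simp only: of_int_le_iff)
  also have "\<dots> = H * of_int B ^ 5" by (simp add: H_def)
  also have "\<dots> \<le> H * t ^ 5"
    using assms H_ge_1 by (intro mult_left_mono power_mono) (auto simp: B_def)
  finally show ?thesis by simp
qed

lemma h_nonzero: "x \<noteq> 0 \<or> z \<noteq> 0 \<Longrightarrow> h x z \<noteq> 0"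
  using binary_form_nonzero[OF irr deg] by simp

text \<open>Modulo \<open>m\<close> the vector is b(r, 1), where the form has the value b^5 F(r).
  This is applied to short lattice vectors, whose coordinates may have a common factor.\<close>

lemma dvd_h_lattice:
  assumes "int m dvd a - r * b" "r \<in> roots_mod F m"
  shows "int m dvd h a b"
proof -
  have "[h a b = h (b * r) (b * 1)] (mod int m)"
    using assms(1) by (intro binary_form_cong) (simp_all add: cong_iff_dvd_diff mult.commute)
  also have "h (b * r) (b * 1) = b ^ 5 * poly F r"
    unfolding binary_form_scale using deg by (simp add: binary_form_one)
  also have "[\<dots> = 0] (mod int m)" using assms(2) by (simp add: roots_mod_def cong_0_iff)
  finally show ?thesis by (simp add: cong_0_iff)
qed

text \<open>A common divisor of z and \<open>m\<close> divides \<open>coeff F 5\<close> times x^5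
  but is coprime to both factors. Hence z is invertible modulo \<open>m\<close>, and r =
  x/z.\<close>

lemma exists_root_mod:
  assumes "gcd x z = 1" "int m dvd h x z" "coprime (int m) (coeff F 5)" "m > 0"
  obtains r where "r \<in> roots_mod F m" "int m dvd x - r * z"
proof -
  have "coprime z (int m)"
  proof (rule coprimeI)
    fix d assume d: "d dvd z" "d dvd int m"
    have "[h x z = h x 0] (mod d)" using d(1) by (intro binary_form_cong) (simp_all add: cong_0_iff)
    moreover have "d dvd h x z" using d(2) assms(2) by (rule dvd_trans)
    ultimately have "d dvd coeff F 5 * x ^ 5" by (simp add: binary_form_zero_right cong_dvd_iff)
    moreover have "coprime d (coeff F 5)" using d(2) assms(3) by (meson coprime_divisors dvd_refl)
    moreover have "coprime d x"
      using d(1) assms(1) by (meson coprime_divisors coprime_iff_gcd_eq_1 dvd_refl coprime_commute)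
    ultimately show "is_unit d" by (metis coprime_common_divisor coprime_mult_right_iff coprime_power_right_iff dvd_refl)
  qed
  then obtain w where w: "[z * w = 1] (mod int m)" using cong_solve_coprime_int by blast
  define r where "r = (x * w) mod int m"
  have "[r = x * w] (mod int m)" by (simp add: r_def cong_def)
  then have "[r * z = x * w * z] (mod int m)" by (rule cong_mult) simp
  also have "x * w * z = x * (z * w)" by (simp add: mult_ac)
  also have "[\<dots> = x * 1] (mod int m)" using w by (intro cong_mult) auto
  finally have rz: "[x = z * r] (mod int m)" by (simp add: cong_sym mult.commute)
  then have dvd: "int m dvd x - r * z" by (simp add: cong_iff_dvd_diff mult.commute)
  have "[h x z = h (z * r) (z * 1)] (mod int m)" using rz by (intro binary_form_cong) simp_all
  also have "h (z * r) (z * 1) = z ^ 5 * poly F r"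
    unfolding binary_form_scale using deg by (simp add: binary_form_one)
  finally have "int m dvd z ^ 5 * poly F r" using assms(2) by (simp add: cong_dvd_iff)
  then have "int m dvd poly F r"
    using \<open>coprime z (int m)\<close> by (simp add: coprime_dvd_mult_right_iff coprime_commute)
  then have "r \<in> roots_mod F m" using assms(4) by (simp add: roots_mod_def r_def)
  with dvd that show thesis by blast
qed

text \<open>Each lattice of index p^2 > N^2 has at most 2 + 36 points, and the at most five roots
  modulo p^2 give 190 = 5 * 38 per prime. The lower bounds on \<open>N\<close> keep p from dividing
  \<open>R\<close> or the leading coefficient.\<close>

lemma card_small_primes_le:
  fixes N :: nat
  assumes AB: "A * F + B * pderiv F = [:R:]" "R \<noteq> 0" and N: "\<bar>R\<bar> \<le> int N" "\<bar>coeff F 5\<bar> \<le> int N" and "M \<ge> 0"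
  shows "real (card {(x, z) \<in> primitive_points (N). \<exists>p :: nat. prime p \<and> p > N \<and> real p \<le> M \<and>
     (int p)\<^sup>2 dvd h x z}) \<le> 190 * M"
proof -
  define Ps where "Ps = {p :: nat. prime p \<and> p > N \<and> real p \<le> M}"
  have "Ps \<subseteq> {1..nat \<lfloor>M\<rfloor>}"
    using \<open>M \<ge> 0\<close> by (auto simp: Ps_def le_nat_floor)
  then have "finite Ps" "card Ps \<le> nat \<lfloor>M\<rfloor>"
    using finite_subset card_mono[of "{1..nat \<lfloor>M\<rfloor>}" Ps] by auto
  then have cP: "real (card Ps) \<le> M" using \<open>M \<ge> 0\<close> by linarith
  have notdvd: "\<not> int p dvd c" if "p \<in> Ps" "c \<noteq> 0" "\<bar>c\<bar> \<le> int N" for p c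
    using that dvd_imp_le_int[of c "int p"] by (auto simp: Ps_def)
  have "{(x, z) \<in> primitive_points N. \<exists>p :: nat. prime p \<and> p > N \<and> real p \<le> M \<and> (int p)\<^sup>2 dvd h x z}
     \<subseteq> (\<Union>p\<in>Ps. \<Union>r\<in>roots_mod F (p\<^sup>2). lattice_points N (p\<^sup>2) r)" (is "?S \<subseteq> ?U")
  proof safe
    fix x z p assume xz: "(x, z) \<in> primitive_points N"
      and p: "prime p" "p > N" "real p \<le> M" "(int p)\<^sup>2 dvd h x z"
    then have "p \<in> Ps" by (simp add: Ps_def)
    have "\<not> int p dvd coeff F 5" using notdvd[OF \<open>p \<in> Ps\<close> lead_nonzero] N by simp
    then have cop: "coprime (int (p\<^sup>2)) (coeff F 5)" using p(1) by (simp add: prime_imp_coprime)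
    have "gcd x z = 1" using xz by (simp add: primitive_points_def)
    moreover have "int (p\<^sup>2) dvd h x z" using p(4) by simp
    moreover have "p\<^sup>2 > 0" using p(1) by (simp add: prime_gt_0_nat)
    ultimately obtain r where r: "r \<in> roots_mod F (p\<^sup>2)" "int (p\<^sup>2) dvd x - r * z"
      using exists_root_mod[OF _ _ cop, of x z] by metis
    then have "(x, z) \<in> lattice_points N (p\<^sup>2) r" using xz by (simp add: lattice_points_def)
    then show "(x, z) \<in> ?U" using \<open>p \<in> Ps\<close> r(1) by blast
  qed
  then have "real (card ?S) \<le> real (card ?U)"
    using \<open>finite Ps\<close> by (intro of_nat_mono card_mono) auto
  also have "\<dots> \<le> real (card Ps) * 190"
  proof (rule card_UN_le_mult[OF \<open>finite Ps\<close>])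
    fix p assume p: "p \<in> Ps"
    have "N < p" using p by (simp add: Ps_def)
    have "real (card (lattice_points N (p\<^sup>2) r)) \<le> 38" for r
    proof -
      have "real (card (lattice_points N (p\<^sup>2) r)) \<le> 2 + 36 * (real N)\<^sup>2 / real (p\<^sup>2)"
        using \<open>N < p\<close> by (intro card_lattice_points_le) auto
      moreover have "(real N)\<^sup>2 / real (p\<^sup>2) \<le> 1" using \<open>N < p\<close> by (simp add: power_mono)
      ultimately show ?thesis by simp
    qed
    then have "real (card (\<Union>r\<in>roots_mod F (p\<^sup>2). lattice_points N (p\<^sup>2) r))
        \<le> real (card (roots_mod F (p\<^sup>2))) * 38"
      by (intro card_UN_le_mult) auto
    also have "card (roots_mod F (p\<^sup>2)) \<le> 5"
      using card_roots_mod_prime_square_le[OF AB(1), of p] notdvd[OF p AB(2)] notdvd[OF p lead_nonzero] N p deg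
      by (simp add: Ps_def)
    finally show "real (card (\<Union>r\<in>roots_mod F (p\<^sup>2). lattice_points N (p\<^sup>2) r)) \<le> 190" by simp
  qed
  finally show ?thesis using cP by simp
qed

text \<open>\<open>c\<close> carries the sign of the value and the part of the squarefree factor
  shared with the leading coefficient, so it takes boundedly many values.\<close>

definition square_class_points :: "nat \<Rightarrow> nat \<Rightarrow> int \<Rightarrow> (int \<times> int) set" where
  "square_class_points N m r = {(x, z) \<in> lattice_points N m r.
     \<exists>c y. c \<noteq> 0 \<and> \<bar>c\<bar> \<le> \<bar>coeff F 5\<bar> \<and> y \<noteq> 0 \<and> h x z = c * int m * y\<^sup>2}"

lemma finite_square_class_points [simp]: "finite (square_class_points N m r)"
  by (rule finite_subset[of _ "lattice_points N m r"]) (auto simp: square_class_points_def)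

lemma exists_square_class:
  assumes "(x, z) \<in> primitive_points N" "(int p)\<^sup>2 dvd h x z" "real p > M" "M > 0"
  obtains m r where "squarefree m" "coprime (int m) (coeff F 5)" "real m \<le> H * real N ^ 5 / M\<^sup>2"
    "r \<in> roots_mod F m" "(x, z) \<in> square_class_points N m r"
proof -
  have xz: "gcd x z = 1" "\<bar>x\<bar> \<le> int N" "\<bar>z\<bar> \<le> int N" using assms(1) by (auto simp: primitive_points_def)
  then have "x \<noteq> 0 \<or> z \<noteq> 0" by auto
  then have hnz: "h x z \<noteq> 0" by (rule h_nonzero)
  obtain d where d: "h x z = (int p)\<^sup>2 * d" using assms(2) by (auto simp: dvd_def)
  then have "d \<noteq> 0" using hnz by auto
  define e where "e = squarefree_part d"
  define g where "g = square_part d"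
  have deg': "d = e * g\<^sup>2" unfolding e_def g_def by (rule squarefree_decompose)
  have "squarefree e" by (simp add: e_def)
  have "e \<noteq> 0" "g \<noteq> 0" using deg' \<open>d \<noteq> 0\<close> by auto
  \<comment> \<open>Removing this gcd once is enough: \<open>e\<close> is squarefree, so the
    cofactor \<open>w\<close> is coprime to \<open>b\<close> and therefore to the leading
    coefficient.\<close>
  define b where "b = gcd e (coeff F 5)"
  have "b dvd e" by (simp add: b_def)
  then obtain w where w: "e = b * w" ..
  have "b \<noteq> 0" "w \<noteq> 0" using \<open>e \<noteq> 0\<close> w by auto
  define m where "m = nat \<bar>w\<bar>"
  define c where "c = b * sgn w"
  have ecm: "e = c * int m" by (simp add: c_def m_def w mult.assoc sgn_mult_abs)
  have "coprime b w"
  proof (rule coprimeI)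
    fix k assume "k dvd b" "k dvd w"
    then have "k\<^sup>2 dvd e" unfolding w power2_eq_square by (rule mult_dvd_mono)
    then show "is_unit k" using \<open>squarefree e\<close> by (rule squarefreeD[rotated])
  qed
  have "squarefree w" using \<open>squarefree e\<close> w by (metis dvd_triv_right squarefree_mono)
  have "m > 0" using \<open>w \<noteq> 0\<close> by (simp add: m_def)
  have "coprime (int m) (coeff F 5)"
  proof (rule coprimeI)
    fix k assume k: "k dvd int m" "k dvd coeff F 5"
    then have "k dvd w" by (simp add: m_def)
    then have "k dvd e" unfolding w by simp
    then have "k dvd b" using k(2) by (simp add: b_def)
    then show "is_unit k" using \<open>k dvd w\<close> \<open>coprime b w\<close> by (rule coprime_common_divisor[rotated])
  qed
  have "int m dvd h x z" by (simp add: d deg' ecm)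
  obtain r where r: "r \<in> roots_mod F m" "int m dvd x - r * z"
    using exists_root_mod[OF xz(1) \<open>int m dvd h x z\<close> \<open>coprime (int m) (coeff F 5)\<close> \<open>m > 0\<close>] by blast
  show thesis
  proof (rule that[OF _ \<open>coprime (int m) (coeff F 5)\<close> _ r(1)])
    show "squarefree m"
    proof (rule squarefreeI)
      fix k :: nat assume "k\<^sup>2 dvd m"
      then have "int k ^ 2 dvd int m" by (metis of_nat_dvd_iff of_nat_power)
      then have "int k ^ 2 dvd w" by (simp add: m_def)
      then have "is_unit (int k)" using \<open>squarefree w\<close> by (rule squarefreeD[rotated])
      then show "is_unit k" by simp
    qed
    \<comment> \<open>The factor p^2 > M^2 has been removed from the value, so |d|, and with it
      \<open>m\<close>, is at most H N^5/M^2.\<close>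
    have "int m dvd d" by (simp add: deg' ecm)
    then have "int m \<le> \<bar>d\<bar>" using dvd_imp_le_int[OF \<open>d \<noteq> 0\<close>, of "int m"] by simp
    then have "real m \<le> \<bar>real_of_int d\<bar>" by linarith
    moreover have "\<bar>real_of_int d\<bar> * M\<^sup>2 \<le> H * real N ^ 5"
    proof -
      have "\<bar>real_of_int d\<bar> * M\<^sup>2 \<le> \<bar>real_of_int d\<bar> * (real p)\<^sup>2"
        using assms(3,4) by (intro mult_left_mono power_mono) auto
      also have "\<dots> = \<bar>real_of_int (h x z)\<bar>" by (simp add: d abs_mult)
      also have "\<dots> \<le> H * real N ^ 5" using xz by (intro abs_h_le) linarith+
      finally show ?thesis .
    qed
    moreover have "real m * M\<^sup>2 \<le> \<bar>real_of_int d\<bar> * M\<^sup>2"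
      using \<open>real m \<le> \<bar>real_of_int d\<bar>\<close> by (intro mult_right_mono) auto
    ultimately have "real m * M\<^sup>2 \<le> H * real N ^ 5" by linarith
    then show "real m \<le> H * real N ^ 5 / M\<^sup>2"
      using assms(4) by (simp add: pos_le_divide_eq)
    have "(x, z) \<in> lattice_points N m r" using assms(1) r(2) by (simp add: lattice_points_def)
    moreover have "c \<noteq> 0" using \<open>b \<noteq> 0\<close> \<open>w \<noteq> 0\<close> by (simp add: c_def sgn_eq_0_iff)
    moreover have "\<bar>c\<bar> \<le> \<bar>coeff F 5\<bar>"
    proof -
      have "\<bar>c\<bar> = \<bar>b\<bar>" using \<open>w \<noteq> 0\<close> by (simp add: c_def abs_mult abs_sgn_eq)
      moreover have "b dvd coeff F 5" by (simp add: b_def)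
      ultimately show ?thesis using dvd_imp_le_int[OF lead_nonzero, of b] by simp
    qed
    moreover have "g * int p \<noteq> 0"
    proof -
      have "int p \<noteq> 0" using d hnz by auto
      then show ?thesis using \<open>g \<noteq> 0\<close> by simp
    qed
    moreover have "h x z = c * int m * (g * int p)\<^sup>2"
      by (simp add: d deg' ecm power_mult_distrib)
    ultimately show "(x, z) \<in> square_class_points N m r"
      unfolding square_class_points_def by blast
  qed
qed

text \<open>
  Either the lattice has a very short vector, and there are few such lattices, or both sides of
  the coordinate box are long and the square sieve saves a power.
\<close>

lemma card_square_class_points_le:
  fixes P :: "nat set"
  assumes "m > 0" "N > 0" "W \<ge> 1" "finite P" "P \<noteq> {}" and P: "\<And>q. q \<in> P \<Longrightarrow> prime q \<and> q > 2 \<and> q \<le> B"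
    and few: "\<And>y :: int. y \<noteq> 0 \<Longrightarrow> real_of_int (y\<^sup>2) \<le> H\<^sup>2 * real m * real N ^ 5 \<Longrightarrow>
      2 * card {q\<in>P. int q dvd y} \<le> card P"
  shows "(\<exists>a b. (a, b) \<noteq> (0, 0) \<and> int m dvd a - r * b \<and>
       \<bar>real_of_int a\<bar> \<le> W * real m / (2 * real N) \<and> \<bar>real_of_int b\<bar> \<le> W * real m / (2 * real N)) \<or>
     real (card (square_class_points N m r))
       \<le> 288 * H * (real N)\<^sup>2 / real m * (1 / real (card P) + (real B)\<^sup>2 / W)"
proof -
  obtain a b c e :: int and l :: nat where ab: "int m dvd a - r * b" "int l = max \<bar>a\<bar> \<bar>b\<bar>" "l > 0" "l\<^sup>2 \<le> m"
    and coord: "\<And>x z. int m dvd x - r * z \<Longrightarrow> \<exists>u v. x = u * a + v * c \<and> z = u * b + v * e \<and>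
      (\<forall>N. \<bar>x\<bar> \<le> N \<longrightarrow> \<bar>z\<bar> \<le> N \<longrightarrow> \<bar>u\<bar> * int l \<le> 2 * N \<and> \<bar>v\<bar> * int m \<le> 2 * int l * N)"
    using exists_reduced_lattice_basis[OF assms(1), of r] by metis
  define U where "U = 2 * real N / real l"
  define V where "V = 2 * real l * real N / real m"
  have "U > 0" "V > 0" using assms ab by (simp_all add: U_def V_def)
  show ?thesis
  \<comment> \<open>V < W means l < Wm/(2N), so the short basis vector itself witnesses the first
    alternative.\<close>
  proof (cases "V < W")
    case True
    then have "real l \<le> W * real m / (2 * real N)"
      using assms by (simp add: V_def field_simps)
    moreover have "\<bar>real_of_int a\<bar> \<le> real l" "\<bar>real_of_int b\<bar> \<le> real l" using ab(2) by linarith+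
    moreover have "(a, b) \<noteq> (0, 0)" using ab(2,3) by auto
    ultimately show ?thesis using ab(1) by (meson order_trans)
  next
    case False
    then have "V \<ge> 1" using assms(3) by simp
    have "real l * real l \<le> real m"
      using ab(4) by (metis of_nat_le_iff of_nat_mult power2_eq_square)
    then have "V \<le> U" using ab(3) assms by (simp add: U_def V_def field_simps)
    then have "U \<ge> 1" using \<open>V \<ge> 1\<close> by simp
    have UV: "U * V = 4 * (real N)\<^sup>2 / real m"
      using ab(3) by (simp add: U_def V_def power2_eq_square)
    define X where "X = nat (2 * \<lfloor>U\<rfloor> + 1)"
    define Y where "Y = nat (2 * \<lfloor>V\<rfloor> + 1)"
    have X: "int X = 2 * \<lfloor>U\<rfloor> + 1" and Y: "int Y = 2 * \<lfloor>V\<rfloor> + 1"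
      using \<open>U \<ge> 1\<close> \<open>V \<ge> 1\<close> by (simp_all add: X_def Y_def)
    have X3: "real X \<le> 3 * U" and Y3: "real Y \<le> 3 * V" and Xpos: "X > 0" "Y > 0"
      using X Y \<open>U \<ge> 1\<close> \<open>V \<ge> 1\<close> by linarith+
    define box where "box = {- \<lfloor>U\<rfloor>..<- \<lfloor>U\<rfloor> + int X} \<times> {- \<lfloor>V\<rfloor>..<- \<lfloor>V\<rfloor> + int Y}"
    define \<phi> where "\<phi> = (\<lambda>(u, v). (u * a + v * c, u * b + v * e))"
    define S where "S = (\<lambda>k. {(u, v) \<in> box. \<exists>y. k * int m * h (u * a + v * c) (u * b + v * e) = y\<^sup>2 \<and>
      2 * card {q\<in>P. int q dvd y} \<le> card P})"
    define r' where "r' = card P"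
    have "r' > 0" using assms by (simp add: r'_def card_gt_0_iff)
    have S: "real (card (S k)) \<le> 144 * (real N)\<^sup>2 / real m * (1 / real r' + (real B)\<^sup>2 / W)" for k
    proof -
      interpret odd_form "\<lambda>u v. h (u * a + v * c) (u * b + v * e)" 5
      proof
        fix t u v
        have "t * u * a + t * v * c = t * (u * a + v * c)" "t * u * b + t * v * e = t * (u * b + v * e)"
          by (simp_all add: algebra_simps)
        then show "h (t * u * a + t * v * c) (t * u * b + t * v * e) = t ^ 5 * h (u * a + v * c) (u * b + v * e)"
          by (simp only: binary_form_scale)
      qed (auto intro!: binary_form_cong cong_add cong_mult)
      have "card (S k) * r' \<le> 4 * (X * Y) + 4 * r' * B\<^sup>2 * (X + Y)"
        unfolding r'_def
        by (rule square_sieve[OF assms(4) P, where k = "k * int m" and a = "- \<lfloor>U\<rfloor>" and b = "- \<lfloor>V\<rfloor>"])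
          (auto simp: S_def box_def)
      then have "real (card (S k) * r') \<le> real (4 * (X * Y) + 4 * r' * B\<^sup>2 * (X + Y))"
        by (simp only: of_nat_le_iff)
      also have "\<dots> = 4 * (real X * real Y) + 4 * real r' * (real B)\<^sup>2 * (real X + real Y)" by simp
      also have "\<dots> \<le> 4 * ((3 * U) * (3 * V)) + 4 * real r' * (real B)\<^sup>2 * (3 * U + 3 * V)"
        using X3 Y3 \<open>U > 0\<close> \<open>V > 0\<close> by (intro add_mono mult_left_mono mult_mono) auto
      also have "\<dots> \<le> 36 * (U * V) + 4 * real r' * (real B)\<^sup>2 * (6 * (U * V / W))"
      proof -
        \<comment> \<open>V \<ge> W bounds the perimeter term 3U + 3V by 6/W times the area UV; this
          is the use of the case distinction.\<close>
        have "U * W \<le> U * V" using False \<open>U > 0\<close> by simp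
        then have "U \<le> U * V / W" using assms(3) by (simp add: pos_le_divide_eq)
        then have "3 * U + 3 * V \<le> 6 * (U * V / W)" using \<open>V \<le> U\<close> by linarith
        then show ?thesis by (intro add_mono mult_left_mono) auto
      qed
      also have "\<dots> \<le> 36 * (U * V) * (1 + real r' * (real B)\<^sup>2 / W)"
      proof -
        define t where "t = U * V * (real r' * (real B)\<^sup>2 / W)"
        have "t \<ge> 0" using \<open>U > 0\<close> \<open>V > 0\<close> assms(3) by (simp add: t_def)
        moreover have "4 * real r' * (real B)\<^sup>2 * (6 * (U * V / W)) = 24 * t" by (simp add: t_def)
        moreover have "36 * (U * V) * (1 + real r' * (real B)\<^sup>2 / W) = 36 * (U * V) + 36 * t"
          by (simp add: t_def algebra_simps)
        ultimately show ?thesis by linarith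
      qed
      also have "\<dots> = (144 * (real N)\<^sup>2 / real m * (1 / real r' + (real B)\<^sup>2 / W)) * real r'"
      proof -
        have "(1 / real r' + (real B)\<^sup>2 / W) * real r' = 1 + real r' * (real B)\<^sup>2 / W"
          using \<open>r' > 0\<close> by (simp add: distrib_right)
        then show ?thesis unfolding UV by (simp only: mult.assoc)
      qed
      finally have "real (card (S k)) * real r'
        \<le> (144 * (real N)\<^sup>2 / real m * (1 / real r' + (real B)\<^sup>2 / W)) * real r'"
        by (simp only: of_nat_mult)
      then show ?thesis by (rule mult_right_le_imp_le) (use \<open>r' > 0\<close> in simp)
    qed
    \<comment> \<open>One sieve for each of the at most 2H nonzero values of \<open>c\<close>, which
      turns the factor 144 into 288 H.\<close>
    define Cs where "Cs = {- \<bar>coeff F 5\<bar>..\<bar>coeff F 5\<bar>} - {0}"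
    have "finite box" by (simp add: box_def)
    then have finS: "finite (S k)" for k by (rule finite_subset[rotated]) (auto simp: S_def)
    have "square_class_points N m r \<subseteq> \<phi> ` (\<Union>k\<in>Cs. S k)"
    proof
      fix s assume "s \<in> square_class_points N m r"
      then obtain x z k y where s: "s = (x, z)" "(x, z) \<in> lattice_points N m r" "k \<noteq> 0"
        "\<bar>k\<bar> \<le> \<bar>coeff F 5\<bar>" "y \<noteq> 0" "h x z = k * int m * y\<^sup>2"
        by (auto simp: square_class_points_def)
      have xz: "int m dvd x - r * z" "\<bar>x\<bar> \<le> int N" "\<bar>z\<bar> \<le> int N"
        using s(2) by (auto simp: lattice_points_def primitive_points_def)
      then obtain u v where uv: "x = u * a + v * c" "z = u * b + v * e"
        "\<bar>u\<bar> * int l \<le> 2 * int N" "\<bar>v\<bar> * int m \<le> 2 * int l * int N"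
        using coord by blast
      have "\<bar>real_of_int u\<bar> * real l \<le> 2 * real N"
        using of_int_le_iff[of "\<bar>u\<bar> * int l" "2 * int N", where ?'a = real, THEN iffD2, OF uv(3)] by simp
      then have "\<bar>real_of_int u\<bar> \<le> U" using ab(3) by (simp add: U_def pos_le_divide_eq)
      moreover have "\<bar>real_of_int v\<bar> * real m \<le> 2 * real l * real N"
        using of_int_le_iff[of "\<bar>v\<bar> * int m" "2 * int l * int N", where ?'a = real, THEN iffD2, OF uv(4)] by simp
      then have "\<bar>real_of_int v\<bar> \<le> V" using assms(1) by (simp add: V_def pos_le_divide_eq)
      ultimately have "(u, v) \<in> box"
        unfolding box_def X Y by (auto simp: abs_le_iff) linarith+
      \<comment> \<open>Multiplying the value k m y^2 by k m makes it a square, so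
        \<open>k * int m\<close> is the multiplier handed to the sieve.\<close>
      define w where "w = k * int m * y"
      have "k * int m * h x z = w\<^sup>2" by (simp add: s(6) w_def power2_eq_square)
      moreover have "w \<noteq> 0" using s assms(1) by (simp add: w_def)
      moreover have "real_of_int (w\<^sup>2) \<le> H\<^sup>2 * real m * real N ^ 5"
      proof -
        have "real_of_int (w\<^sup>2) = \<bar>real_of_int (k * int m * h x z)\<bar>"
          using \<open>k * int m * h x z = w\<^sup>2\<close> by simp
        also have "\<dots> = \<bar>real_of_int k\<bar> * real m * \<bar>real_of_int (h x z)\<bar>" by (simp add: abs_mult)
        also have "\<dots> \<le> H * real m * (H * real N ^ 5)"
        proof (intro mult_mono)
          have "\<bar>k\<bar> \<le> (\<Sum>j\<le>5. \<bar>coeff F j\<bar>)"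
            using s(4) member_le_sum[of 5 "{..5}" "\<lambda>j. \<bar>coeff F j\<bar>"] by simp
          then show "\<bar>real_of_int k\<bar> \<le> H" unfolding H_def by (metis of_int_abs of_int_le_iff)
          show "\<bar>real_of_int (h x z)\<bar> \<le> H * real N ^ 5" using xz by (intro abs_h_le) linarith+
        qed (use H_ge_1 in auto)
        finally show ?thesis by (simp add: power2_eq_square mult_ac)
      qed
      ultimately have "(u, v) \<in> S k"
        using few[of w] \<open>(u, v) \<in> box\<close> by (auto simp: S_def uv(1,2))
      moreover have "k \<in> Cs" using s by (auto simp: Cs_def)
      moreover have "s = \<phi> (u, v)" by (simp add: \<phi>_def s uv(1,2))
      ultimately show "s \<in> \<phi> ` (\<Union>k\<in>Cs. S k)" by blast
    qed
    then have "real (card (square_class_points N m r)) \<le> real (card (\<Union>k\<in>Cs. S k))"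
      using finS by (intro of_nat_mono surj_card_le[rotated]) (auto simp: Cs_def)
    also have "real (card (\<Union>k\<in>Cs. S k))
        \<le> real (card Cs) * (144 * (real N)\<^sup>2 / real m * (1 / real r' + (real B)\<^sup>2 / W))"
      using S by (intro card_UN_le_mult) (auto simp: Cs_def)
    also have "\<dots> \<le> (2 * H) * (144 * (real N)\<^sup>2 / real m * (1 / real r' + (real B)\<^sup>2 / W))"
    proof (intro mult_right_mono)
      have "card Cs = card {- \<bar>coeff F 5\<bar>..\<bar>coeff F 5\<bar>} - 1" by (simp add: Cs_def)
      then have "real (card Cs) = 2 * real_of_int \<bar>coeff F 5\<bar>" by simp
      also have "real_of_int \<bar>coeff F 5\<bar> \<le> H"
        unfolding H_def of_int_le_iff by (rule member_le_sum) auto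
      finally show "real (card Cs) \<le> 2 * H" by simp
    qed (use assms(3) in auto)
    also have "\<dots> = 288 * H * (real N)\<^sup>2 / real m * (1 / real r' + (real B)\<^sup>2 / W)" by simp
    finally show ?thesis unfolding r'_def by (rule disjI2)
  qed
qed

end

lemma sum_inverse_le: "n \<ge> 1 \<Longrightarrow> (\<Sum>k\<in>{1..n}. 1 / real k) \<le> 1 + ln (real n)"
proof (induction n rule: dec_induct)
  case (step n)
  have "ln (real n / real (Suc n)) \<le> real n / real (Suc n) - 1"
    using step by (intro ln_le_minus_one) auto
  then have "ln (real n) - ln (real (Suc n)) \<le> real n / real (Suc n) - 1"
    using step by (simp add: ln_div)
  moreover have "real n / real (Suc n) - 1 = - (1 / real (Suc n))" by (simp add: field_simps)
  ultimately have "1 / real (Suc n) \<le> ln (real (Suc n)) - ln (real n)" by linarith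
  then show ?case using step by simp
qed simp

context irreducible_quintic
begin

text \<open>A short vector w belongs to few pairs (m, r): \<open>m\<close> is a squarefree divisor
  of the nonzero number h(w), and there are at most 5 roots per prime of \<open>m\<close>. With 2
  choices per prime of h(w) for the divisor, this gives 10 to the number of primes.\<close>

lemma card_skew_lattices_le:
  fixes K C \<epsilon> :: real
  assumes "K \<ge> 1" "\<epsilon> \<ge> 0" and C: "C \<ge> 0" "\<And>n :: nat. n > 0 \<Longrightarrow> 10 ^ card (prime_factors n) \<le> C * real n powr \<epsilon>"
  defines "Q \<equiv> {(m, r). squarefree m \<and> coprime (int m) (coeff F 5) \<and> r \<in> roots_mod F m \<and>
    (\<exists>a b. (a, b) \<noteq> (0, 0) \<and> int m dvd a - r * b \<and> \<bar>real_of_int a\<bar> \<le> K \<and> \<bar>real_of_int b\<bar> \<le> K)}"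
  shows "finite Q" "real (card Q) \<le> 9 * K\<^sup>2 * (C * (H * K ^ 5) powr \<epsilon>)"
proof -
  define I where "I = {u :: int. \<bar>real_of_int u\<bar> \<le> K}"
  \<comment> \<open>All roots modulo \<open>m\<close> are counted here, without recording which of
    them have the vector in their lattice.\<close>
  define T where "T = (\<lambda>(a, b). SIGMA m:{m. m dvd nat \<bar>h a b\<bar> \<and> squarefree m \<and> coprime (int m) (coeff F 5)}. roots_mod F m)"
  have I: "finite I" "real (card I) \<le> 3 * K"
    unfolding I_def using card_int_interval_le[OF assms(1)] by auto
  have T: "finite (T s) \<and> real (card (T s)) \<le> C * (H * K ^ 5) powr \<epsilon>" if s: "s \<in> I \<times> I - {(0, 0)}" for s
  proof -
    obtain a b where ab: "s = (a, b)" "(a, b) \<noteq> (0, 0)" "\<bar>real_of_int a\<bar> \<le> K" "\<bar>real_of_int b\<bar> \<le> K"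
      using s by (cases s) (auto simp: I_def)
    define n where "n = nat \<bar>h a b\<bar>"
    have "h a b \<noteq> 0" using ab(2) by (intro h_nonzero) auto
    then have "n > 0" by (simp add: n_def)
    define D where "D = {m. m dvd n \<and> squarefree m \<and> coprime (int m) (coeff F 5)}"
    have D: "D \<subseteq> {m. m dvd n \<and> squarefree m}" by (auto simp: D_def)
    then have "finite D" using card_squarefree_divisors_le(1)[OF \<open>n > 0\<close>] by (rule finite_subset)
    have Ts: "T s = (SIGMA m:D. roots_mod F m)" by (simp add: T_def ab(1) D_def n_def)
    have "card (T s) = (\<Sum>m\<in>D. card (roots_mod F m))"
      unfolding Ts using \<open>finite D\<close> by (intro card_SigmaI) auto
    also have "\<dots> \<le> (\<Sum>m\<in>D. 5 ^ card (prime_factors n))"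
    proof (rule sum_mono)
      fix m assume m: "m \<in> D"
      then have "card (roots_mod F m) \<le> 5 ^ card (prime_factors m)"
        using card_roots_mod_squarefree_le[of m F] deg by (auto simp: D_def)
      also have "card (prime_factors m) \<le> card (prime_factors n)"
        using m \<open>n > 0\<close> by (intro card_mono dvd_prime_factors) (auto simp: D_def)
      then have "(5::nat) ^ card (prime_factors m) \<le> 5 ^ card (prime_factors n)" by (intro power_increasing) auto
      finally show "card (roots_mod F m) \<le> 5 ^ card (prime_factors n)" .
    qed
    also have "\<dots> = card D * 5 ^ card (prime_factors n)" by simp
    also have "\<dots> \<le> 2 ^ card (prime_factors n) * 5 ^ card (prime_factors n)"
    proof (intro mult_right_mono)
      have "card D \<le> card {m. m dvd n \<and> squarefree m}"
        using D card_squarefree_divisors_le(1)[OF \<open>n > 0\<close>] by (intro card_mono)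
      then show "card D \<le> 2 ^ card (prime_factors n)"
        using card_squarefree_divisors_le(2)[OF \<open>n > 0\<close>] by simp
    qed simp
    also have "\<dots> = 10 ^ card (prime_factors n)" by (simp flip: power_mult_distrib)
    finally have "real (card (T s)) \<le> real (10 ^ card (prime_factors n))" by (simp only: of_nat_le_iff)
    also have "\<dots> \<le> C * real n powr \<epsilon>" using C(2)[OF \<open>n > 0\<close>] by simp
    also have "\<dots> \<le> C * (H * K ^ 5) powr \<epsilon>"
    proof (intro mult_left_mono powr_mono2)
      have "real n = \<bar>real_of_int (h a b)\<bar>" by (simp add: n_def)
      also have "\<dots> \<le> H * K ^ 5" using ab by (intro abs_h_le)
      finally show "real n \<le> H * K ^ 5" .
    qed (use assms in auto)
    finally show ?thesis using \<open>finite D\<close> by (simp add: Ts)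
  qed
  have "Q \<subseteq> (\<Union>s\<in>I \<times> I - {(0, 0)}. T s)"
  proof safe
    fix m r assume "(m, r) \<in> Q"
    then obtain a b where *: "squarefree m" "coprime (int m) (coeff F 5)" "r \<in> roots_mod F m"
      "(a, b) \<noteq> (0, 0)" "int m dvd a - r * b" "\<bar>real_of_int a\<bar> \<le> K" "\<bar>real_of_int b\<bar> \<le> K"
      unfolding Q_def by blast
    have "int m dvd h a b" using *(5,3) by (rule dvd_h_lattice)
    then have "m dvd nat \<bar>h a b\<bar>" by (simp add: nat_dvd_iff flip: int_dvd_int_iff)
    then have "(m, r) \<in> T (a, b)" using * by (simp add: T_def)
    moreover have "(a, b) \<in> I \<times> I - {(0, 0)}" using * by (simp add: I_def)
    ultimately show "(m, r) \<in> (\<Union>s\<in>I \<times> I - {(0, 0)}. T s)" by blast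
  qed
  moreover have fin: "finite (\<Union>s\<in>I \<times> I - {(0, 0)}. T s)" using I T by blast
  ultimately show "finite Q" by (rule finite_subset)
  have "real (card Q) \<le> real (card (\<Union>s\<in>I \<times> I - {(0, 0)}. T s))"
    using \<open>Q \<subseteq> _\<close> fin by (intro of_nat_mono card_mono)
  also have "\<dots> \<le> real (card (I \<times> I - {(0, 0)})) * (C * (H * K ^ 5) powr \<epsilon>)"
    using I T by (intro card_UN_le_mult) auto
  also have "\<dots> \<le> (9 * K\<^sup>2) * (C * (H * K ^ 5) powr \<epsilon>)"
  proof (intro mult_right_mono)
    have "card (I \<times> I - {(0, 0)}) \<le> card (I \<times> I)" using I by (intro card_mono) auto
    then have "real (card (I \<times> I - {(0, 0)})) \<le> real (card I) * real (card I)"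
      by (simp add: card_cartesian_product flip: of_nat_mult)
    also have "\<dots> \<le> (3 * K) * (3 * K)" using I assms(1) by (intro mult_mono) auto
    finally show "real (card (I \<times> I - {(0, 0)})) \<le> 9 * K\<^sup>2" by (simp add: power2_eq_square)
  qed (use C in auto)
  finally show "real (card Q) \<le> 9 * K\<^sup>2 * (C * (H * K ^ 5) powr \<epsilon>)" .
qed

text \<open>The first term is the number of skew lattices times the largest possible number of
  points on one. In the second, the sieve bound is proportional to 1/m, so summing over
  \<open>m\<close> costs the number of roots and a harmonic sum.\<close>

lemma card_large_primes_le:
  fixes P :: "nat set" and C \<epsilon> W K M D :: real
  assumes "N > 0" "M > 0" "W \<ge> 1" "K \<ge> 1" "\<epsilon> \<ge> 0" and D: "D = H * real N ^ 5 / M\<^sup>2" "D \<ge> 1"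
    and WK: "W * D / (2 * real N) \<le> K"
    and C: "C \<ge> 0" "\<And>n :: nat. n > 0 \<Longrightarrow> 10 ^ card (prime_factors n) \<le> C * real n powr \<epsilon>"
    and "finite P" "P \<noteq> {}" and P: "\<And>q. q \<in> P \<Longrightarrow> prime q \<and> q > 2 \<and> q \<le> B"
    and few: "\<And>y :: int. y \<noteq> 0 \<Longrightarrow> real_of_int (y\<^sup>2) \<le> H\<^sup>2 * D * real N ^ 5 \<Longrightarrow>
      2 * card {q\<in>P. int q dvd y} \<le> card P"
  shows "real (card {(x, z) \<in> primitive_points N. \<exists>p :: nat. prime p \<and> real p > M \<and> (int p)\<^sup>2 dvd h x z})
    \<le> 9 * K\<^sup>2 * (C * (H * K ^ 5) powr \<epsilon>) * (20 * real N * W)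
      + 288 * H * (real N)\<^sup>2 * (1 / real (card P) + (real B)\<^sup>2 / W) * (C * D powr \<epsilon> * (1 + ln D))"
    (is "real (card ?S) \<le> ?A + ?B")
proof -
  define Ms where "Ms = {m. squarefree m \<and> coprime (int m) (coeff F 5) \<and> real m \<le> D}"
  define E where "E = 288 * H * (real N)\<^sup>2 * (1 / real (card P) + (real B)\<^sup>2 / W)"
  have "E \<ge> 0" using H_ge_1 assms(3) by (simp add: E_def)
  have pos: "m > 0" if "m \<in> Ms" for m using that not_squarefree_0 by (auto simp: Ms_def intro: Nat.gr0I)
  have "Ms \<subseteq> {1..nat \<lfloor>D\<rfloor>}" using pos by (auto simp: Ms_def le_nat_floor Suc_leI)
  then have "finite Ms" by (rule finite_subset) simp
  define Prs where "Prs = (SIGMA m:Ms. roots_mod F m)"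
  have "finite Prs" using \<open>finite Ms\<close> by (simp add: Prs_def)
  define Skew where "Skew = {(m, r) \<in> Prs. \<exists>a b. (a, b) \<noteq> (0, 0) \<and> int m dvd a - r * b \<and>
    \<bar>real_of_int a\<bar> \<le> W * real m / (2 * real N) \<and> \<bar>real_of_int b\<bar> \<le> W * real m / (2 * real N)}"
  define sc where "sc = (\<lambda>(m, r). square_class_points N m r)"
  have "?S \<subseteq> (\<Union>s\<in>Skew. sc s) \<union> (\<Union>s\<in>Prs - Skew. sc s)"
  proof safe
    fix x z p assume xz: "(x, z) \<in> primitive_points N" "real p > M" "(int p)\<^sup>2 dvd h x z"
      "(x, z) \<notin> (\<Union>s\<in>Prs - Skew. sc s)"
    obtain m r where "squarefree m" "coprime (int m) (coeff F 5)" "real m \<le> D"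
      "r \<in> roots_mod F m" "(x, z) \<in> square_class_points N m r"
      using exists_square_class[OF xz(1,3,2) assms(2)] D(1) by blast
    then have "(m, r) \<in> Prs" "(x, z) \<in> sc (m, r)" by (auto simp: Prs_def Ms_def sc_def)
    then show "(x, z) \<in> (\<Union>s\<in>Skew. sc s)" using xz(4) by blast
  qed
  moreover have fS: "finite Skew"
    using \<open>finite Prs\<close> by (rule finite_subset[rotated]) (auto simp: Skew_def)
  have "finite (sc s)" for s by (simp add: sc_def case_prod_beta)
  then have "finite (\<Union>s\<in>Skew. sc s)" "finite (\<Union>s\<in>Prs - Skew. sc s)"
    using \<open>finite Prs\<close> fS by auto
  ultimately have "card ?S \<le> card (\<Union>s\<in>Skew. sc s) + card (\<Union>s\<in>Prs - Skew. sc s)"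
    by (meson card_Un_le card_mono finite_UnI order_trans)
  then have "real (card ?S) \<le> real (card (\<Union>s\<in>Skew. sc s)) + real (card (\<Union>s\<in>Prs - Skew. sc s))"
    by linarith
  moreover have "real (card (\<Union>s\<in>Skew. sc s)) \<le> ?A"
  proof -
    have "real (card (\<Union>s\<in>Skew. sc s)) \<le> real (card Skew) * (20 * real N * W)"
    proof (rule card_UN_le_mult[OF fS])
      fix s assume "s \<in> Skew"
      then obtain m r a b where s: "s = (m, r)" "(m, r) \<in> Prs" "(a, b) \<noteq> (0, 0)"
        "\<bar>real_of_int a\<bar> \<le> W * real m / (2 * real N)" "\<bar>real_of_int b\<bar> \<le> W * real m / (2 * real N)"
        by (auto simp: Skew_def)
      have "m > 0" using s(2) pos by (auto simp: Prs_def)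
      \<comment> \<open>A nonzero integer vector has a coordinate of size at least 1, so a skew
        lattice has m \<ge> 2N/W and 2 + 36 N^2/m \<le> 2 + 18 NW \<le> 20 NW.\<close>
      have "1 \<le> \<bar>real_of_int a\<bar> \<or> 1 \<le> \<bar>real_of_int b\<bar>" using s(3) by auto
      then have "1 \<le> W * real m / (2 * real N)" using s(4,5) by linarith
      then have "2 * real N \<le> W * real m" using assms(1) by (simp add: pos_le_divide_eq)
      then have "2 * real N * real N \<le> W * real m * real N" by (rule mult_right_mono) simp
      then have "2 * ((real N)\<^sup>2 / real m) \<le> W * real N"
        using \<open>m > 0\<close> by (simp add: pos_divide_le_eq power2_eq_square mult_ac)
      moreover have "real (card (sc s)) \<le> 2 + 36 * (real N)\<^sup>2 / real m"
      proof -
        have "card (sc s) \<le> card (lattice_points N m r)"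
          unfolding s(1) sc_def by (auto intro!: card_mono simp: square_class_points_def)
        then show ?thesis using card_lattice_points_le[OF \<open>m > 0\<close>, of N r] by linarith
      qed
      moreover have "1 \<le> W * real N" using assms(1,3) mult_mono[of 1 W 1 "real N"] by simp
      moreover have "36 * (real N)\<^sup>2 / real m = 36 * ((real N)\<^sup>2 / real m)"
        "20 * real N * W = 20 * (W * real N)" by simp_all
      ultimately show "real (card (sc s)) \<le> 20 * real N * W" by linarith
    qed
    also have "\<dots> \<le> (9 * K\<^sup>2 * (C * (H * K ^ 5) powr \<epsilon>)) * (20 * real N * W)"
    proof (intro mult_right_mono)
      let ?Q = "{(m, r). squarefree m \<and> coprime (int m) (coeff F 5) \<and> r \<in> roots_mod F m \<and>
        (\<exists>a b. (a, b) \<noteq> (0, 0) \<and> int m dvd a - r * b \<and> \<bar>real_of_int a\<bar> \<le> K \<and> \<bar>real_of_int b\<bar> \<le> K)}"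
      have "Skew \<subseteq> ?Q"
      proof safe
        fix m r assume "(m, r) \<in> Skew"
        then obtain a b where s: "(m, r) \<in> Prs" "(a, b) \<noteq> (0, 0)" "int m dvd a - r * b"
          "\<bar>real_of_int a\<bar> \<le> W * real m / (2 * real N)" "\<bar>real_of_int b\<bar> \<le> W * real m / (2 * real N)"
          by (auto simp: Skew_def)
        have "W * real m / (2 * real N) \<le> W * D / (2 * real N)"
          using s(1) assms(3) by (intro divide_right_mono mult_left_mono) (auto simp: Prs_def Ms_def)
        then have "W * real m / (2 * real N) \<le> K" using WK by simp
        then have "\<bar>real_of_int a\<bar> \<le> K" "\<bar>real_of_int b\<bar> \<le> K" using s(4,5) by linarith+
        then show "\<exists>a b. (a, b) \<noteq> (0, 0) \<and> int m dvd a - r * b \<and> \<bar>real_of_int a\<bar> \<le> K \<and> \<bar>real_of_int b\<bar> \<le> K"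
          using s(2,3) by blast
      qed (auto simp: Skew_def Prs_def Ms_def)
      then have "card Skew \<le> card ?Q"
        using card_skew_lattices_le(1)[OF assms(4,5) C] by (intro card_mono)
      then show "real (card Skew) \<le> 9 * K\<^sup>2 * (C * (H * K ^ 5) powr \<epsilon>)"
        using card_skew_lattices_le(2)[OF assms(4,5) C] by linarith
    qed (use assms(3) in auto)
    finally show ?thesis .
  qed
  moreover have "real (card (\<Union>s\<in>Prs - Skew. sc s)) \<le> ?B"
  proof -
    have "real (card (\<Union>s\<in>Prs - Skew. sc s)) \<le> (\<Sum>s\<in>Prs - Skew. real (card (sc s)))"
      using card_UN_le[of "Prs - Skew" sc] \<open>finite Prs\<close> by (metis finite_Diff of_nat_le_iff of_nat_sum)
    also have "\<dots> \<le> (\<Sum>s\<in>Prs - Skew. E / real (fst s))"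
    proof (rule sum_mono)
      fix s assume s: "s \<in> Prs - Skew"
      obtain m r where mr: "s = (m, r)" by (cases s)
      have m: "m \<in> Ms" using s mr by (auto simp: Prs_def)
      have few': "2 * card {q\<in>P. int q dvd y} \<le> card P"
        if "y \<noteq> 0" "real_of_int (y\<^sup>2) \<le> H\<^sup>2 * real m * real N ^ 5" for y
      proof (rule few[OF that(1)])
        have "H\<^sup>2 * real m * real N ^ 5 \<le> H\<^sup>2 * D * real N ^ 5"
          using m by (intro mult_right_mono mult_left_mono) (auto simp: Ms_def)
        then show "real_of_int (y\<^sup>2) \<le> H\<^sup>2 * D * real N ^ 5" using that(2) by linarith
      qed
      have "real (card (square_class_points N m r))
          \<le> 288 * H * (real N)\<^sup>2 / real m * (1 / real (card P) + (real B)\<^sup>2 / W)"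
        using card_square_class_points_le[OF pos[OF m] assms(1,3,11,12) P few', of r] s
        unfolding mr Skew_def by blast
      then show "real (card (sc s)) \<le> E / real (fst s)" by (simp add: mr sc_def E_def)
    qed
    also have "\<dots> \<le> (\<Sum>s\<in>Prs. E / real (fst s))"
      using \<open>finite Prs\<close> \<open>E \<ge> 0\<close> by (intro sum_mono2) auto
    also have "\<dots> = (\<Sum>m\<in>Ms. \<Sum>r\<in>roots_mod F m. E / real m)"
      unfolding Prs_def using \<open>finite Ms\<close> by (subst sum.Sigma) (auto simp: case_prod_beta)
    also have "\<dots> = (\<Sum>m\<in>Ms. real (card (roots_mod F m)) * (E / real m))" by simp
    also have "\<dots> \<le> (\<Sum>m\<in>Ms. E * (C * D powr \<epsilon>) * (1 / real m))"
    proof (rule sum_mono)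
      fix m assume m: "m \<in> Ms"
      have "card (roots_mod F m) \<le> 5 ^ card (prime_factors m)"
        using m card_roots_mod_squarefree_le[of m F] deg by (auto simp: Ms_def)
      then have "real (card (roots_mod F m)) \<le> 5 ^ card (prime_factors m)"
        by (metis of_nat_le_iff of_nat_numeral of_nat_power)
      \<comment> \<open>Weakened so that the constant \<open>C\<close> from the skew lattices can be
        reused.\<close>
      also have "\<dots> \<le> 10 ^ card (prime_factors m)" by (intro power_mono) auto
      also have "\<dots> \<le> C * real m powr \<epsilon>" using C(2) pos[OF m] .
      also have "\<dots> \<le> C * D powr \<epsilon>"
        using m C(1) assms(5) by (intro mult_left_mono powr_mono2) (auto simp: Ms_def)
      finally have "real (card (roots_mod F m)) * (E / real m) \<le> (C * D powr \<epsilon>) * (E / real m)"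
        using \<open>E \<ge> 0\<close> by (intro mult_right_mono) auto
      then show "real (card (roots_mod F m)) * (E / real m) \<le> E * (C * D powr \<epsilon>) * (1 / real m)"
        by (simp add: mult_ac)
    qed
    also have "\<dots> = E * (C * D powr \<epsilon>) * (\<Sum>m\<in>Ms. 1 / real m)" by (rule sum_distrib_left[symmetric])
    also have "\<dots> \<le> E * (C * D powr \<epsilon>) * (1 + ln D)"
    proof (rule mult_left_mono)
      have "(\<Sum>m\<in>Ms. 1 / real m) \<le> (\<Sum>m\<in>{1..nat \<lfloor>D\<rfloor>}. 1 / real m)"
        using \<open>Ms \<subseteq> {1..nat \<lfloor>D\<rfloor>}\<close> by (intro sum_mono2) auto
      also have "\<dots> \<le> 1 + ln (real (nat \<lfloor>D\<rfloor>))" using D(2) by (intro sum_inverse_le) (simp add: le_nat_floor)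
      also have "ln (real (nat \<lfloor>D\<rfloor>)) \<le> ln D" using D(2) by (subst ln_le_cancel_iff) auto
      finally show "(\<Sum>m\<in>Ms. 1 / real m) \<le> 1 + ln D" by simp
    qed (use \<open>E \<ge> 0\<close> C(1) in simp)
    finally show ?thesis unfolding E_def by (simp only: mult.assoc)
  qed
  ultimately show ?thesis by linarith
qed

end

section \<open>Choice of the parameters and conclusion\<close>

lemma many_odd_primes:
  fixes x :: real
  assumes "x \<ge> 1" "x powr (2/25) \<ge> 4"
    and "x powr (7/100) \<le> (x powr (2/25) / 2 - 1) * ln 4 / (2/25 * ln x) - 2"
  obtains P :: "nat set" and B :: nat where "finite P" "P \<noteq> {}" "\<And>q. q \<in> P \<Longrightarrow> prime q \<and> q > 2 \<and> q \<le> B"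
    "real (card P) \<ge> x powr (7/100)" "real B \<le> x powr (2/25)"
proof -
  define n where "n = nat \<lfloor>x powr (2/25) / 2\<rfloor>"
  have n: "real n \<le> x powr (2/25) / 2" "real n \<ge> x powr (2/25) / 2 - 1" "n \<ge> 1"
    using assms(2) unfolding n_def by linarith+
  define P where "P = {p. prime p \<and> p \<le> 2 * n} - {2}"
  have fin: "finite {p :: nat. prime p \<and> p \<le> 2 * n}" by simp
  define L where "L = ln (2 * real n)"
  have "L > 0" using n(3) by (simp add: L_def)
  have "L \<le> ln (x powr (2/25))" unfolding L_def using n by (subst ln_le_cancel_iff) auto
  also have "\<dots> = 2/25 * ln x" using assms(1) by (simp add: ln_powr)
  finally have "L \<le> 2/25 * ln x" .
  \<comment> \<open>Of the 2 subtracted in the assumption, one unit pays for the term ln(2n) in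
    Chebyshev's bound and one for discarding the prime 2. The drop from 2/25 to 7/100 absorbs the
    logarithm.\<close>
  have "(x powr (2/25) / 2 - 1) * ln 4 / (2/25 * ln x) \<le> real n * ln 4 / L"
    using n(2) \<open>L > 0\<close> \<open>L \<le> 2/25 * ln x\<close> assms(2) by (intro frac_le mult_right_mono) auto
  also have "\<dots> - 1 \<le> real (card {p. prime p \<and> p \<le> 2 * n})"
  proof -
    have "real n * ln 4 - L \<le> real (card {p. prime p \<and> p \<le> 2 * n}) * L"
      unfolding L_def by (rule chebyshev_lower_bound[OF n(3)])
    then show ?thesis using \<open>L > 0\<close> by (simp add: pos_divide_le_eq algebra_simps)
  qed
  moreover have "card {p. prime p \<and> p \<le> 2 * n} \<le> card P + 1"
    unfolding P_def using fin by (simp add: card_Diff_singleton_if) arith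
  ultimately have "x powr (7/100) \<le> real (card P)" using assms(3) by linarith
  moreover have "x powr (7/100) \<ge> 1" using assms(1) by (simp add: ge_one_powr_ge_zero)
  ultimately have "P \<noteq> {}" by auto
  moreover have "prime q \<and> q > 2 \<and> q \<le> 2 * n" if "q \<in> P" for q
    using that prime_ge_2_nat[of q] by (auto simp: P_def)
  moreover have "finite P" using fin by (simp add: P_def)
  moreover have "real (2 * n) \<le> x powr (2/25)" using n(1) by simp
  ultimately show thesis using that \<open>x powr (7/100) \<le> real (card P)\<close> by blast
qed

text \<open>A product of k distinct primes is at least 2^k, and |y| \<le> y^2 for an integer y; the
  size is known for y^2, which is the value being sieved.\<close>

lemma card_prime_divisors_le:
  fixes y :: int
  assumes "y \<noteq> 0" "finite P" "\<And>q. q \<in> P \<Longrightarrow> prime q" "real_of_int (y\<^sup>2) \<le> t"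
  shows "real (card {q\<in>P. int q dvd y}) \<le> log 2 t"
proof -
  define n where "n = nat \<bar>y\<bar>"
  have "n > 0" using assms(1) by (simp add: n_def)
  have "{q\<in>P. int q dvd y} \<subseteq> prime_factors n"
    using assms(3) \<open>n > 0\<close> by (auto simp: in_prime_factors_iff n_def nat_dvd_iff simp flip: int_dvd_int_iff)
  then have "card {q\<in>P. int q dvd y} \<le> card (prime_factors n)" by (intro card_mono) auto
  then have "(2::nat) ^ card {q\<in>P. int q dvd y} \<le> 2 ^ card (prime_factors n)" by (intro power_increasing) auto
  also have "\<dots> \<le> n" by (rule two_power_card_prime_factors_le[OF \<open>n > 0\<close>])
  also have "n \<le> n\<^sup>2" using \<open>n > 0\<close> by (simp add: power2_eq_square)
  finally have "real (2 ^ card {q\<in>P. int q dvd y}) \<le> real (n\<^sup>2)" by (simp only: of_nat_le_iff)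
  also have "real (n\<^sup>2) = real_of_int (y\<^sup>2)" by (simp add: n_def)
  finally have "2 powr real (card {q\<in>P. int q dvd y}) \<le> t" using assms(4) by (simp add: powr_realpow)
  moreover have "t > 0"
  proof -
    have "0 < real_of_int (y\<^sup>2)" using assms(1) by simp
    then show ?thesis using assms(4) by linarith
  qed
  ultimately show ?thesis by (simp add: le_log_iff)
qed

context irreducible_quintic
begin

lemma eventually_card_large_primes_le:
  "\<forall>\<^sub>F N :: nat in sequentially.
    real (card {(x, z) \<in> primitive_points N. \<exists>p :: nat. prime p \<and> real p > real N powr (39/20) \<and> (int p)\<^sup>2 dvd h x z})
      \<le> real N powr (39/20)"
proof -
  obtain C where C: "C \<ge> 1" "\<And>n :: nat. n > 0 \<Longrightarrow> 10 ^ card (prime_factors n) \<le> C * real n powr (1/200)"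
    using power_card_prime_factors_le[of 10 "1/200"] by auto
  have "H > 0" "C > 0" using H_ge_1 C(1) by auto
  define D where "D = (\<lambda>x. H * x ^ 5 / (x powr (39/20))\<^sup>2)"
  \<comment> \<open>The exponent of WD/N for W = N^(6/25): 6/25 + (5 - 39/10) - 1 = 17/50.\<close>
  define K where "K = (\<lambda>x. H * x powr (17/50))"
  have ev1: "\<forall>\<^sub>F x in at_top. x powr (7/100) \<le> (x powr (2/25) / 2 - 1) * ln 4 / (2/25 * ln x) - (2::real)"
    by real_asymp
  have ev2: "\<forall>\<^sub>F x in at_top. x powr (2/25) \<ge> (4::real)" by real_asymp
  \<comment> \<open>The square roots to be tested are bounded by a power of x, so they have O(ln x)
    prime factors, fewer than half the primes of the sieve.\<close>
  have ev3: "\<forall>\<^sub>F x in at_top. 2 * log 2 (H\<^sup>2 * D x * x ^ 5) \<le> x powr (7/100)"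
    unfolding D_def log_def using \<open>H > 0\<close> by real_asymp
  have ev4: "\<forall>\<^sub>F x in at_top. D x \<ge> 1" unfolding D_def using \<open>H > 0\<close> by real_asymp
  \<comment> \<open>The main exponents are 2 * 17/50 + 1 + 6/25 = 1.92 for the skew lattices, and 2
    - 7/100 = 1.93 and 2 + 4/25 - 6/25 = 1.92 for the sieve. The powers 1/200 add less than 0.01,
    which with the logarithm stays below 39/20 = 1.95.\<close>
  have ev5: "\<forall>\<^sub>F x in at_top. 9 * (K x)\<^sup>2 * (C * (H * K x ^ 5) powr (1/200)) * (20 * x * x powr (6/25))
      + 288 * H * x\<^sup>2 * (1 / x powr (7/100) + (x powr (2/25))\<^sup>2 / x powr (6/25)) * (C * D x powr (1/200) * (1 + ln (D x)))
      \<le> x powr (39/20)"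
    unfolding D_def K_def using \<open>H > 0\<close> \<open>C > 0\<close> by real_asymp
  have "\<forall>\<^sub>F x in at_top. x \<ge> (1::real) \<and>
      x powr (7/100) \<le> (x powr (2/25) / 2 - 1) * ln 4 / (2/25 * ln x) - 2 \<and> x powr (2/25) \<ge> 4 \<and>
      2 * log 2 (H\<^sup>2 * D x * x ^ 5) \<le> x powr (7/100) \<and> D x \<ge> 1 \<and>
      9 * (K x)\<^sup>2 * (C * (H * K x ^ 5) powr (1/200)) * (20 * x * x powr (6/25))
      + 288 * H * x\<^sup>2 * (1 / x powr (7/100) + (x powr (2/25))\<^sup>2 / x powr (6/25)) * (C * D x powr (1/200) * (1 + ln (D x)))
      \<le> x powr (39/20)"
    by (intro eventually_conj ev1 ev2 ev3 ev4 ev5 eventually_ge_at_top)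
  then have "\<forall>\<^sub>F N in sequentially. real N \<ge> 1 \<and>
      real N powr (7/100) \<le> (real N powr (2/25) / 2 - 1) * ln 4 / (2/25 * ln (real N)) - 2 \<and> real N powr (2/25) \<ge> 4 \<and>
      2 * log 2 (H\<^sup>2 * D (real N) * real N ^ 5) \<le> real N powr (7/100) \<and> D (real N) \<ge> 1 \<and>
      9 * (K (real N))\<^sup>2 * (C * (H * K (real N) ^ 5) powr (1/200)) * (20 * real N * real N powr (6/25))
      + 288 * H * (real N)\<^sup>2 * (1 / real N powr (7/100) + (real N powr (2/25))\<^sup>2 / real N powr (6/25))
        * (C * D (real N) powr (1/200) * (1 + ln (D (real N)))) \<le> real N powr (39/20)"
    by (rule eventually_compose_filterlim) (rule filterlim_real_sequentially)
  then show ?thesis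
  proof eventually_elim
    case (elim N)
    define x where "x = real N"
    note e = elim[folded x_def]
    have "N > 0" "x \<ge> 1" using e by (auto simp: x_def)
    obtain P B where P: "finite P" "P \<noteq> {}" "\<And>q. q \<in> P \<Longrightarrow> prime q \<and> q > 2 \<and> q \<le> B"
      "real (card P) \<ge> x powr (7/100)" "real B \<le> x powr (2/25)"
      using many_odd_primes[of x] e by blast
    have few: "2 * card {q\<in>P. int q dvd y} \<le> card P"
      if "y \<noteq> 0" "real_of_int (y\<^sup>2) \<le> H\<^sup>2 * D x * real N ^ 5" for y :: int
    proof -
      have "real (card {q\<in>P. int q dvd y}) \<le> log 2 (H\<^sup>2 * D x * x ^ 5)"
        using that P by (intro card_prime_divisors_le) (auto simp: x_def)
      then have "2 * real (card {q\<in>P. int q dvd y}) \<le> real (card P)" using e P(4) by linarith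
      then show ?thesis by linarith
    qed
    have K1: "K x \<ge> 1"
      unfolding K_def using H_ge_1 \<open>x \<ge> 1\<close> mult_mono[of 1 H 1 "x powr (17/50)"] by (simp add: ge_one_powr_ge_zero)
    have WK: "x powr (6/25) * D x / (2 * real N) \<le> K x"
    proof -
      have "(x powr (39/20))\<^sup>2 = x powr (39/10)" by (simp add: power2_eq_square flip: powr_add)
      moreover have "x ^ 5 = x powr 5" using \<open>x \<ge> 1\<close> by (simp add: powr_numeral)
      ultimately have "x powr (6/25) * D x / (2 * real N)
          = H * (x powr (6/25) * x powr 5 / (x powr (39/10) * x powr 1)) / 2"
        using \<open>x \<ge> 1\<close> by (simp add: D_def x_def mult_ac)
      also have "x powr (6/25) * x powr 5 / (x powr (39/10) * x powr 1) = x powr (6/25 + 5 - (39/10 + 1))"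
        by (simp only: powr_add powr_diff)
      also have "6/25 + 5 - (39/10 + 1) = (17/50 :: real)" by simp
      also have "H * x powr (17/50) / 2 \<le> K x" using H_ge_1 by (simp add: K_def)
      finally show ?thesis .
    qed
    define M where "M = real N powr (39/20)"
    have "real (card {(x, z) \<in> primitive_points N. \<exists>p :: nat. prime p \<and> real p > M \<and> (int p)\<^sup>2 dvd h x z})
      \<le> 9 * (K x)\<^sup>2 * (C * (H * K x ^ 5) powr (1/200)) * (20 * real N * x powr (6/25))
      + 288 * H * (real N)\<^sup>2 * (1 / real (card P) + (real B)\<^sup>2 / x powr (6/25)) * (C * D x powr (1/200) * (1 + ln (D x)))"
    proof (rule card_large_primes_le)
      show "N > 0" "K x \<ge> 1" by fact+
      show "D x = H * real N ^ 5 / M\<^sup>2" by (simp add: D_def M_def x_def)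
      show "x powr (6/25) \<ge> 1" using \<open>x \<ge> 1\<close> by (simp add: ge_one_powr_ge_zero)
      show "M > 0" using \<open>N > 0\<close> by (simp add: M_def)
    qed (use e C WK P(1-3) few in auto)
    also have "\<dots> \<le> 9 * (K x)\<^sup>2 * (C * (H * K x ^ 5) powr (1/200)) * (20 * x * x powr (6/25))
      + 288 * H * x\<^sup>2 * (1 / x powr (7/100) + (x powr (2/25))\<^sup>2 / x powr (6/25)) * (C * D x powr (1/200) * (1 + ln (D x)))"
    proof -
      have "1 / real (card P) + (real B)\<^sup>2 / x powr (6/25) \<le> 1 / x powr (7/100) + (x powr (2/25))\<^sup>2 / x powr (6/25)"
        using P \<open>x \<ge> 1\<close> by (intro add_mono divide_left_mono divide_right_mono power_mono) (auto intro!: mult_pos_pos simp: card_gt_0_iff)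
      moreover have "0 \<le> C * D x powr (1/200) * (1 + ln (D x))" using e \<open>C > 0\<close> by simp
      moreover have "0 \<le> 288 * H * x\<^sup>2" using \<open>H > 0\<close> by simp
      ultimately show ?thesis
        unfolding x_def[symmetric] by (intro add_left_mono mult_right_mono mult_left_mono)
    qed
    also have "\<dots> \<le> x powr (39/20)" using e by blast
    finally show ?case by (simp only: x_def M_def)
  qed
qed

text \<open>191 = 190 + 1, from the primes up to N^(39/20) and beyond it.\<close>

lemma eventually_delta_le:
  assumes f: "f = homogenize 5 F"
  shows "\<forall>\<^sub>F N in sequentially. real (delta f N) \<le> 191 * real N powr (39/20)"
proof -
  obtain A B R where AB: "A * F + B * pderiv F = [:R:]" "R \<noteq> 0"
    using bezout_pderiv_irreducible[OF irr] deg by auto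
  have "\<forall>\<^sub>F N in sequentially. \<bar>c\<bar> \<le> int N" for c
    using eventually_ge_at_top[of "nat \<bar>c\<bar>"] by eventually_elim linarith
  from eventually_card_large_primes_le this[of R] this[of "coeff F 5"] show ?thesis
  proof eventually_elim
    case (elim N)
    define M where "M = real N powr (39/20)"
    let ?S1 = "{(x, z) \<in> primitive_points N. \<exists>p :: nat. prime p \<and> p > N \<and> real p \<le> M \<and> (int p)\<^sup>2 dvd h x z}"
    let ?S2 = "{(x, z) \<in> primitive_points N. \<exists>p :: nat. prime p \<and> real p > M \<and> (int p)\<^sup>2 dvd h x z}"
    have "{(x, z). \<bar>x\<bar> \<le> int N \<and> \<bar>z\<bar> \<le> int N \<and> gcd x z = 1 \<and>
       (\<exists>p :: int. prime p \<and> p > int N \<and> p\<^sup>2 dvd eval2 f x z)} \<subseteq> ?S1 \<union> ?S2" (is "?S \<subseteq> _")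
    proof
      fix s assume "s \<in> ?S"
      then obtain x z p where *: "s = (x, z)" "\<bar>x\<bar> \<le> int N" "\<bar>z\<bar> \<le> int N" "gcd x z = 1"
        "prime p" "p > int N" "p\<^sup>2 dvd eval2 f x z"
        by (cases s) auto
      define q where "q = nat p"
      have q: "prime q" "q > N" "int q = p" using *(5,6) by (auto simp: q_def prime_ge_0_int)
      have "(int q)\<^sup>2 dvd h x z" using *(7) unfolding q(3) f eval2_homogenize .
      moreover have "(x, z) \<in> primitive_points N" using *(2-4) by (simp add: primitive_points_def)
      ultimately show "s \<in> ?S1 \<union> ?S2" using q(1,2) *(1) by (cases "real q \<le> M") auto
    qed
    moreover have "finite ?S1" "finite ?S2"
      by (rule finite_subset[of _ "primitive_points N"]; auto)+
    ultimately have "card ?S \<le> card ?S1 + card ?S2"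
      by (meson card_Un_le card_mono finite_UnI order_trans)
    then have "real (card ?S) \<le> real (card ?S1) + real (card ?S2)" by linarith
    moreover have "real (card ?S1) \<le> 190 * M"
      using elim by (intro card_small_primes_le[OF AB]) (auto simp: M_def)
    moreover have "real (card ?S2) \<le> M" using elim(1) by (simp only: M_def)
    ultimately show ?case unfolding delta_def by (simp add: M_def)
  qed
qed

end

theorem proposition4p3p15:
  fixes f :: "int poly poly"
  assumes "homogeneous_of_degree 5 f"
    and "irreducible f"
  shows "\<forall>\<epsilon>::real. \<epsilon> > 0 \<longrightarrow>
           (\<exists>C::real. \<forall>N::nat. N \<ge> 1 \<longrightarrow>
              real (delta f N) \<le> C * real N powr ((5 + sqrt 113) / 8 + \<epsilon>))"
proof (intro allI impI)
  fix \<epsilon> :: real assume "\<epsilon> > 0"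
  define \<alpha> where "\<alpha> = (5 + sqrt 113) / 8 + \<epsilon>"
  define s where "s = sqrt 113"
  \<comment> \<open>The value needed for (5 + s)/8 \<ge> 39/20; its square is 112.36.\<close>
  have "s \<ge> 53/5" unfolding s_def by (rule real_le_rsqrt) (simp add: power2_eq_square)
  then have \<alpha>: "39/20 \<le> \<alpha>"
    using \<open>\<epsilon> > 0\<close> unfolding \<alpha>_def s_def[symmetric] by (simp add: field_simps)
  obtain F where F: "f = homogenize 5 F" "degree F = 5" "irreducible F"
    using irreducible_dehomogenize[OF assms] by auto
  interpret irreducible_quintic F by unfold_locales (use F in auto)
  obtain N0 where N0: "\<And>N. N \<ge> N0 \<Longrightarrow> real (delta f N) \<le> 191 * real N powr (39/20)"
    using eventually_delta_le[OF F(1)] unfolding eventually_sequentially by blast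
  \<comment> \<open>The finitely many N < \<open>N0\<close> are absorbed into the constant, as the
    power of N is at least 1.\<close>
  define C where "C = 191 + (\<Sum>N<N0. real (delta f N))"
  have "real (delta f N) \<le> C * real N powr \<alpha>" if "N \<ge> 1" for N
  proof (cases "N \<ge> N0")
    case True
    have "real (delta f N) \<le> 191 * real N powr (39/20)" using N0[OF True] .
    also have "\<dots> \<le> C * real N powr \<alpha>"
      using that \<alpha> by (intro mult_mono powr_mono) (auto simp: C_def sum_nonneg)
    finally show ?thesis .
  next
    case False
    have "real (delta f N) \<le> (\<Sum>N<N0. real (delta f N))"
      using False by (intro member_le_sum) auto
    also have "\<dots> \<le> C * 1" by (simp add: C_def)
    also have "\<dots> \<le> C * real N powr \<alpha>"
      using that \<alpha> by (intro mult_left_mono ge_one_powr_ge_zero) (auto simp: C_def sum_nonneg)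
    finally show ?thesis .
  qed
  then show "\<exists>C. \<forall>N\<ge>1. real (delta f N) \<le> C * real N powr ((5 + sqrt 113) / 8 + \<epsilon>)"
    unfolding \<alpha>_def by blast
qed

end
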